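(* Let $P=(P_{i,j})_{i,j=0,1}$ be any two by two row stochastic matrix with positive entries, and let $A$ be the Hölder normalized potential on $M=\{0,1\}^{\mathbb{N}}$ associated to the shift-invariant Markov probability $\mu_A$ defined by $P$. Then there exist an orthogonal basis $\mathcal{B}=\{\gamma_n,\ n\in\mathbb{N}\}$ of the kernel of the Ruelle operator $\mathscr{L}_A$ and constants $\alpha>0$, $\beta>0$ such that I) the functions $\gamma_n$, $n\in\mathbb{N}$, in the family $\mathcal{B}$ have $C^0$ and $L^2(\mu_A)$ norms uniformly bounded above by the constant $\beta$; II) the functions $\gamma_n$, $n\in\mathbb{N}$, in the family $\mathcal{B}$ have $C^0$ and $L^2(\mu_A)$ norms uniformly bounded below by the constant $\alpha$.
   Context: Let $\pi=(\pi_0,\pi_1)$ be the probability vector with $\pi P=\pi$. The Markov probability is determined by $\mu_A[x_1,\dots,x_n]=\pi_{x_1}P_{x_1,x_2}\cdots P_{x_{n-1},x_n}$ on cylinders of $M=\{0,1\}^{\mathbb{N}}$. The associated potential is $A=\log J$ with $J(x)=P_{x_2,x_1}$ for $x=(x_1,x_2,x_3,\dots)$; it is normalized, i.e. $\sum_{\sigma(y)=x}e^{A(y)}=1$ for all $x$, where $\sigma$ is the shift. The Ruelle operator is $\mathscr{L}_Af(x)=\sum_{\sigma(y)=x}e^{A(y)}f(y)$. Orthogonality and basis refer to the inner product of $L^2(\mu_A)$ (Hilbert basis of the kernel). *)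

theory Defs
  imports "HOL-Probability.Probability"
begin

text \<open>
  The alphabet \<open>{0,1}\<close> is the two-element numeral type \<open>2\<close>, so that \<open>2 \<times> 2\<close> matrices are
  \<open>real^2^2\<close> (\<open>P $ i $ j\<close> is the entry in row \<open>i\<close> and column \<open>j\<close>, with \<open>i, j \<in> {0,1}\<close>).
  A point \<open>(x\<^sub>1, x\<^sub>2, x\<^sub>3, \<dots>)\<close> of \<open>M\<close> is the function \<open>x :: nat \<Rightarrow> 2\<close> with \<open>x k = x\<^sub>k\<^sub>+\<^sub>1\<close>.
\<close>

type_synonym point = "nat \<Rightarrow> 2"

definition M_topology :: "point topology" where
  "M_topology = product_topology (\<lambda>_. discrete_topology UNIV) UNIV"

definition M_algebra :: "point measure" where
  \<comment> \<open>As a sigma-algebra this is the Borel algebra of \<open>M_topology\<close>, generated by the cylinders.\<close>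
  "M_algebra = PiM UNIV (\<lambda>_. count_space UNIV)"

definition shift :: "point \<Rightarrow> point" where
  "shift x = (\<lambda>k. x (Suc k))"

definition positive_stochastic :: "real^2^2 \<Rightarrow> bool" where
  "positive_stochastic P \<longleftrightarrow> (\<forall>i j. P $ i $ j > 0) \<and> (\<forall>i. (\<Sum>j\<in>UNIV. P $ i $ j) = 1)"

definition stationary_vector :: "real^2^2 \<Rightarrow> real^2 \<Rightarrow> bool" where
  "stationary_vector P \<pi> \<longleftrightarrow>
     (\<forall>i. \<pi> $ i \<ge> 0) \<and> (\<Sum>i\<in>UNIV. \<pi> $ i) = 1 \<and> \<pi> v* P = \<pi>"

text \<open>The cylinder \<open>[x\<^sub>1, \<dots>, x\<^sub>n]\<close> with \<open>n = Suc m \<ge> 1\<close> is the set of \<open>y\<close> agreeing with \<open>x\<close> at \<open>0, \<dots>, m\<close>.\<close>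

definition markov_probability :: "real^2^2 \<Rightarrow> real^2 \<Rightarrow> point measure \<Rightarrow> bool" where
  "markov_probability P \<pi> \<mu> \<longleftrightarrow>
     prob_space \<mu> \<and> sets \<mu> = sets M_algebra \<and>
     (\<forall>x m. measure \<mu> {y. \<forall>k\<le>m. y k = x k} = \<pi> $ x 0 * (\<Prod>k<m. P $ x k $ x (Suc k)))"

definition markov_potential :: "real^2^2 \<Rightarrow> point \<Rightarrow> real" where
  \<comment> \<open>\<open>A = log J\<close> with \<open>J(x) = P\<^bsub>x\<^sub>2,x\<^sub>1\<^esub>\<close>\<close>
  "markov_potential P x = ln (P $ x 1 $ x 0)"

definition ruelle :: "(point \<Rightarrow> real) \<Rightarrow> (point \<Rightarrow> real) \<Rightarrow> point \<Rightarrow> real" where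
  "ruelle A f x = (\<Sum>y | shift y = x. exp (A y) * f y)"

definition l2_functions :: "point measure \<Rightarrow> (point \<Rightarrow> real) set" where
  "l2_functions \<mu> = {f \<in> borel_measurable \<mu>. integrable \<mu> (\<lambda>x. (f x)\<^sup>2)}"

definition l2_inner :: "point measure \<Rightarrow> (point \<Rightarrow> real) \<Rightarrow> (point \<Rightarrow> real) \<Rightarrow> real" where
  "l2_inner \<mu> f g = (\<integral>x. f x * g x \<partial>\<mu>)"

definition l2_norm :: "point measure \<Rightarrow> (point \<Rightarrow> real) \<Rightarrow> real" where
  "l2_norm \<mu> f = sqrt (l2_inner \<mu> f f)"

text \<open>Only meaningful for bounded functions, in particular for continuous ones (\<open>M\<close> is compact).\<close>

definition c0_norm :: "(point \<Rightarrow> real) \<Rightarrow> real" where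
  "c0_norm f = (SUP x. \<bar>f x\<bar>)"

text \<open>
  The kernel of the Ruelle operator acting on \<open>L\<^sup>2(\<mu>)\<close>. Elements of \<open>L\<^sup>2(\<mu>)\<close> are given by
  representatives, so vanishing is almost everywhere.
\<close>

definition ruelle_kernel :: "(point \<Rightarrow> real) \<Rightarrow> point measure \<Rightarrow> (point \<Rightarrow> real) set" where
  "ruelle_kernel A \<mu> = {f \<in> l2_functions \<mu>. AE x in \<mu>. ruelle A f x = 0}"

text \<open>
  Orthogonal Hilbert basis of a subspace \<open>V\<close> of \<open>L\<^sup>2(\<mu>)\<close>: nonzero pairwise orthogonal elements of
  \<open>V\<close> whose finite linear combinations are dense in \<open>V\<close> for the \<open>L\<^sup>2\<close> norm.
\<close>

definition l2_orthogonal_basis ::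
    "point measure \<Rightarrow> (point \<Rightarrow> real) set \<Rightarrow> (nat \<Rightarrow> point \<Rightarrow> real) \<Rightarrow> bool" where
  "l2_orthogonal_basis \<mu> V \<gamma> \<longleftrightarrow>
     (\<forall>n. \<gamma> n \<in> V \<and> l2_norm \<mu> (\<gamma> n) \<noteq> 0) \<and>
     (\<forall>m n. m \<noteq> n \<longrightarrow> l2_inner \<mu> (\<gamma> m) (\<gamma> n) = 0) \<and>
     (\<forall>f\<in>V. \<forall>\<epsilon>>0. \<exists>N c. l2_norm \<mu> (\<lambda>x. f x - (\<Sum>n<N. c n * \<gamma> n x)) < \<epsilon>)"

lemma shift_preimage: "{y. shift y = x} = (\<lambda>a. case_nat a x) ` UNIV"
proof (intro set_eqI iffI)
  fix y assume "y \<in> {y. shift y = x}"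
  then have "y = case_nat (y 0) x" by (auto simp: shift_def fun_eq_iff split: nat.split)
  then show "y \<in> (\<lambda>a. case_nat a x) ` UNIV" by blast
qed (auto simp: shift_def)

lemma ruelle_expand: "ruelle A f x = (\<Sum>a\<in>UNIV. exp (A (case_nat a x)) * f (case_nat a x))"
proof -
  have "inj (\<lambda>a::2. case_nat a x)"
    by (rule injI) (metis old.nat.simps(4))
  then show ?thesis
    unfolding ruelle_def shift_preimage by (subst sum.reindex) simp_all
qed

lemma markov_potential_normalized:
  assumes "positive_stochastic P"
  shows "(\<Sum>y | shift y = x. exp (markov_potential P y)) = 1"
  using ruelle_expand[of "markov_potential P" "\<lambda>_. 1" x] assms
  by (simp add: ruelle_def markov_potential_def positive_stochastic_def)

end

theory Submission
  imports Defs
begin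

text \<open>
  The proof has two independent halves.

  First, \<open>L\<^sup>2(\<mu>)\<close> of any Borel probability \<open>\<mu>\<close> on \<open>M\<close> without atoms has an orthogonal basis of
  uniformly bounded continuous functions. The distribution function \<open>F(x) = \<mu>{y. y < x}\<close> of \<open>\<mu>\<close>
  for the lexicographic order is continuous, because there are no atoms; it transports \<open>\<mu>\<close> to
  Lebesgue measure on \<open>[0,1]\<close>, and it maps different cylinders of the same length to intervals
  without common interior points. So the cosines \<open>cos (n \<pi> F)\<close> are orthogonal
  (\<open>integral_cosine_product\<close>) with squared norm \<open>1\<close> or \<open>1/2\<close>, and they span a dense subspace
  (\<open>cosine_complete\<close>): continuous functions of \<open>F\<close> are limits of cosine polynomials by
  Stone-Weierstrass, indicators of cylinders are limits of continuous functions of \<open>F\<close>, and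
  cylinders generate the sigma-algebra.

  Secondly, the kernel of the Ruelle operator is a weighted copy of \<open>L\<^sup>2(\<mu>)\<close>. The equation
  \<open>\<L>f(x) = 0\<close> says that the vector \<open>(f(0x), f(1x))\<close> is orthogonal to the constants for the weights
  \<open>(P\<^bsub>b0\<^esub>, P\<^bsub>b1\<^esub>)\<close>, where \<open>b\<close> is the first letter of \<open>x\<close>. Orthogonality to the constants leaves a
  line in the plane, so \<open>f(ax) = w(b,a) g(x)\<close> for a unit vector \<open>w(b,\<cdot>)\<close> on this line and some
  function \<open>g\<close>. A stationary chain with two states is reversible, hence
  \<open>\<integral> \<L>u d\<mu> = \<integral> u d\<mu>\<close> (\<open>transfer_dual\<close>), and therefore \<open>g \<mapsto> f\<close> is an isometry of \<open>L\<^sup>2(\<mu>)\<close>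
  onto the kernel. It multiplies by a bounded function of the first two letters, so it sends the
  cosines to a basis of the kernel that is continuous and bounded. Its \<open>L\<^sup>2\<close> norms are bounded below,
  and they bound the \<open>C\<^sup>0\<close> norms below.
\<close>

section \<open>Cylinders\<close>

definition cyl :: "point \<Rightarrow> nat \<Rightarrow> point set" where
  "cyl x m = {y. \<forall>k<m. y k = x k}"

lemma mem_cyl [simp]: "x \<in> cyl x m"
  by (simp add: cyl_def)

lemma cyl_0 [simp]: "cyl x 0 = UNIV"
  by (simp add: cyl_def)

lemma cyl_eqI: "y \<in> cyl x m \<Longrightarrow> cyl y m = cyl x m"
  by (auto simp: cyl_def)

lemma cyl_antimono: "m \<le> n \<Longrightarrow> cyl x n \<subseteq> cyl x m"
  by (auto simp: cyl_def)

lemma letter_cases: "a = 0 \<or> a = 1" for a :: 2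
  using exhaust_2[of a] by auto

lemma sum_letters: "(\<Sum>a\<in>(UNIV :: 2 set). h a) = h 0 + h 1"
proof -
  have "(2 :: 2) = 0" by simp
  then show ?thesis using sum_2[of h] by (metis add.commute)
qed

lemma finite_cylinders: "finite (range (\<lambda>x. cyl x m))"
proof (rule finite_subset)
  show "range (\<lambda>x. cyl x m) \<subseteq> (\<lambda>x. cyl x m) ` ({..<m} \<rightarrow>\<^sub>E UNIV)"
  proof
    fix C assume "C \<in> range (\<lambda>x. cyl x m)"
    then obtain x where "C = cyl x m" by auto
    then have "C = cyl (restrict x {..<m}) m" by (auto simp: cyl_def)
    then show "C \<in> (\<lambda>x. cyl x m) ` ({..<m} \<rightarrow>\<^sub>E UNIV)" by auto
  qed
  show "finite ((\<lambda>x. cyl x m) ` ({..<m} \<rightarrow>\<^sub>E (UNIV :: 2 set)))"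
    by (intro finite_imageI finite_PiE) auto
qed

lemma cyl_split:
  "cyl x m = cyl (x(m := 0)) (Suc m) \<union> cyl (x(m := 1)) (Suc m)"
  "cyl (x(m := 0)) (Suc m) \<inter> cyl (x(m := 1)) (Suc m) = {}"
  using letter_cases by (auto simp: cyl_def less_Suc_eq)

lemma space_M_algebra [simp]: "space M_algebra = UNIV"
  by (simp add: M_algebra_def space_PiM)

lemma coordinate_measurable: "(\<lambda>y. y k) \<in> measurable M_algebra (count_space UNIV)"
  unfolding M_algebra_def by (rule measurable_component_singleton) simp

lemma cyl_sets [measurable]: "cyl x m \<in> sets M_algebra"
proof -
  note coordinate_measurable [measurable]
  have "{y \<in> space M_algebra. \<forall>k\<in>{..<m}. y k = x k} \<in> sets M_algebra" by measurable
  then show ?thesis by (simp add: cyl_def Ball_def)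
qed

text \<open>
  Every preimage is a union of cylinders of length \<open>m\<close>, and there are only finitely many of these.
\<close>

lemma prefix_function_measurable:
  assumes h: "\<And>x y. y \<in> cyl x m \<Longrightarrow> h y = h x" and N: "\<And>x. h x \<in> space N"
  shows "h \<in> measurable M_algebra N"
proof (rule measurableI)
  fix S assume "S \<in> sets N"
  have "h -` S \<inter> space M_algebra = \<Union> ((\<lambda>x. cyl x m) ` (h -` S))"
    using h by fastforce
  also have "\<dots> \<in> sets M_algebra"
    by (intro sets.finite_Union finite_subset[OF _ finite_cylinders[of m]]) auto
  finally show "h -` S \<inter> space M_algebra \<in> sets M_algebra" .
qed (use N in auto)

text \<open>
  The identity of two measures will be checked on cylinders for which the prefix is long enough to
  carry a transition. The empty set makes the family closed under intersection.
\<close>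

definition long_cylinders :: "nat \<Rightarrow> point set set" where
  "long_cylinders N = insert {} {cyl x m | x m. N \<le> m}"

lemma Int_stable_long_cylinders: "Int_stable (long_cylinders N)"
proof (rule Int_stableI)
  have *: "cyl x m \<inter> cyl y n \<in> long_cylinders N" if "m \<le> n" "N \<le> n" for x y m n
  proof (cases "cyl x m \<inter> cyl y n = {}")
    case False
    then obtain z where "z \<in> cyl x m" "z \<in> cyl y n" by auto
    then have "cyl x m = cyl z m" "cyl y n = cyl z n" by (simp_all add: cyl_eqI)
    then have "cyl x m \<inter> cyl y n = cyl z n"
      using cyl_antimono[OF \<open>m \<le> n\<close>] by blast
    then show ?thesis using that by (auto simp: long_cylinders_def)
  qed (simp add: long_cylinders_def)
  fix C D assume "C \<in> long_cylinders N" "D \<in> long_cylinders N"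
  then consider "C \<inter> D = {}" | x m y n where "C = cyl x m" "D = cyl y n" "N \<le> m" "N \<le> n"
    by (auto simp: long_cylinders_def)
  then show "C \<inter> D \<in> long_cylinders N"
  proof cases
    case 2
    then show ?thesis
      using *[of m n x y] *[of n m y x] by (cases m n rule: le_cases) (auto simp: Int_commute)
  qed (simp add: long_cylinders_def)
qed

lemma sets_M_algebra_cylinders: "sets M_algebra = sigma_sets UNIV (long_cylinders N)"
proof
  show "sigma_sets UNIV (long_cylinders N) \<subseteq> sets M_algebra"
  proof -
    have "long_cylinders N \<subseteq> sets M_algebra" by (auto simp: long_cylinders_def)
    then show ?thesis using sets.sigma_sets_subset[of "long_cylinders N" M_algebra] by simp
  qed
next
  interpret sigma_algebra UNIV "sigma_sets UNIV (long_cylinders N)"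
    by (rule sigma_algebra_sigma_sets) simp
  have "{y. y i \<in> A} \<in> sigma_sets UNIV (long_cylinders N)" for i and A :: "2 set"
  proof -
    have "{y. y i \<in> A} = \<Union> ((\<lambda>x. cyl x (max N (Suc i))) ` {x. x i \<in> A})"
      using mem_cyl by (fastforce simp: cyl_def)
    also have "\<dots> \<in> sigma_sets UNIV (long_cylinders N)"
      by (intro finite_Union finite_subset[OF _ finite_cylinders[of "max N (Suc i)"]])
        (use max.cobounded1[of N "Suc i"] in \<open>auto intro!: sigma_sets.Basic simp: long_cylinders_def simp del: max.cobounded1\<close>)
    finally show ?thesis .
  qed
  then show "sets M_algebra \<subseteq> sigma_sets UNIV (long_cylinders N)"
    unfolding M_algebra_def sets_PiM_single by (auto intro!: sigma_sets_subset)
qed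

lemma measure_eq_on_long_cylinders:
  assumes "sets \<mu> = sets M_algebra" "sets \<nu> = sets M_algebra"
    and finite: "\<And>x. emeasure \<mu> (cyl x N) \<noteq> \<infinity>"
    and eq: "\<And>x m. N \<le> m \<Longrightarrow> emeasure \<mu> (cyl x m) = emeasure \<nu> (cyl x m)"
  shows "\<mu> = \<nu>"
proof (rule measure_eqI_generator_eq_countable)
  show "Int_stable (long_cylinders N)" by (rule Int_stable_long_cylinders)
  show "sets \<mu> = sigma_sets UNIV (long_cylinders N)" "sets \<nu> = sigma_sets UNIV (long_cylinders N)"
    using assms sets_M_algebra_cylinders by auto
  show "range (\<lambda>x. cyl x N) \<subseteq> long_cylinders N" by (auto simp: long_cylinders_def)
  show "\<Union> (range (\<lambda>x. cyl x N)) = UNIV" using mem_cyl by blast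
  show "countable (range (\<lambda>x. cyl x N))" by (rule countable_finite[OF finite_cylinders])
  show "emeasure \<mu> C \<noteq> \<infinity>" if "C \<in> range (\<lambda>x. cyl x N)" for C
    using that finite by blast
qed (auto simp: long_cylinders_def eq)

lemma cyl_open: "openin M_topology (cyl x m)"
proof -
  have top: "topspace M_topology = UNIV"
    by (simp add: M_topology_def)
  have "openin M_topology {y. y k = x k}" for k
  proof -
    have "continuous_map M_topology (discrete_topology UNIV) (\<lambda>y. y k)"
      unfolding M_topology_def by (rule continuous_map_product_projection) simp
    from openin_continuous_map_preimage[OF this, of "{x k}"] show ?thesis
      by (simp add: top)
  qed
  moreover have "cyl x m = \<Inter> ((\<lambda>k. {y. y k = x k}) ` {..<m}) \<inter> topspace M_topology"
    by (auto simp: cyl_def top)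
  ultimately show ?thesis
    by (cases "m = 0") (auto simp: top intro!: openin_Inter openin_Int openin_topspace[of M_topology, unfolded top])
qed

text \<open>
  Cylinders are a neighbourhood basis of the product topology, so continuity is an \<open>\<epsilon>\<close>-condition in
  which the length of the prefix replaces \<open>\<delta>\<close>.
\<close>

lemma continuous_map_cylindersI:
  fixes f :: "point \<Rightarrow> real"
  assumes "\<And>x \<epsilon>. \<epsilon> > 0 \<Longrightarrow> \<exists>m. \<forall>y\<in>cyl x m. \<bar>f y - f x\<bar> < \<epsilon>"
  shows "continuous_map M_topology euclideanreal f"
proof -
  have "openin M_topology {x. f x \<in> U}" if "open U" for U
    unfolding openin_subopen[of M_topology "{x. f x \<in> U}"]
  proof
    fix x assume "x \<in> {x. f x \<in> U}"
    then obtain \<epsilon> where "\<epsilon> > 0" "ball (f x) \<epsilon> \<subseteq> U"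
      using \<open>open U\<close> open_contains_ball by blast
    moreover obtain m where "\<forall>y\<in>cyl x m. \<bar>f y - f x\<bar> < \<epsilon>" using assms \<open>\<epsilon> > 0\<close> by blast
    ultimately have "cyl x m \<subseteq> {x. f x \<in> U}"
      by (auto simp: dist_real_def abs_minus_commute)
    then show "\<exists>T. openin M_topology T \<and> x \<in> T \<and> T \<subseteq> {x. f x \<in> U}"
      using cyl_open mem_cyl by blast
  qed
  then show ?thesis
    by (simp add: continuous_map_def M_topology_def)
qed

section \<open>The lexicographic distribution function\<close>

locale atomless_cantor = prob_space \<mu> for \<mu> :: "point measure" +
  assumes sets_eq: "sets \<mu> = sets M_algebra"
    and atomless: "measure \<mu> {x} = 0"
begin

lemma space_eq [simp]: "space \<mu> = UNIV"
  using sets_eq_imp_space_eq[OF sets_eq] by simp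

lemma cyl_events [measurable]: "cyl x m \<in> events"
  by (simp add: sets_eq)

definition len :: "nat \<Rightarrow> point \<Rightarrow> real" where
  "len m x = prob (cyl x m)"

text \<open>
  \<open>left_mass m x\<close> is the mass of all points lexicographically below the cylinder \<open>cyl x m\<close>: such a
  point leaves \<open>x\<close> at some place \<open>k < m\<close>, where it has the letter \<open>0\<close> and \<open>x\<close> has the letter \<open>1\<close>. So the
  cylinder owns the interval \<open>[left_mass m x, left_mass m x + len m x]\<close>, and the intervals of the
  cylinders of length \<open>m\<close> tile \<open>[0,1]\<close>.
\<close>

definition left_mass :: "nat \<Rightarrow> point \<Rightarrow> real" where
  "left_mass m x = (\<Sum>k<m. if x k = 1 then len (Suc k) (x(k := 0)) else 0)"

definition lex_cdf :: "point \<Rightarrow> real" where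
  "lex_cdf x = (SUP m. left_mass m x)"

lemma len_nonneg: "0 \<le> len m x"
  by (simp add: len_def)

lemma len_0: "len 0 x = 1"
  using prob_space by (simp add: len_def)

lemma left_mass_0: "left_mass 0 x = 0"
  by (simp add: left_mass_def)

lemma len_split: "len m x = len (Suc m) (x(m := 0)) + len (Suc m) (x(m := 1))"
  using finite_measure_Union[OF cyl_events cyl_events cyl_split(2)[of x m]]
  unfolding len_def cyl_split(1)[of x m] .

lemma len_cong: "y \<in> cyl x m \<Longrightarrow> len m y = len m x"
  by (simp add: len_def cyl_eqI)

lemma left_mass_cong:
  assumes "y \<in> cyl x m"
  shows "left_mass m y = left_mass m x"
proof -
  have "len (Suc k) (y(k := 0)) = len (Suc k) (x(k := 0))" "y k = x k" if "k < m" for k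
    using that assms by (auto intro!: len_cong simp: cyl_def less_Suc_eq)
  then show ?thesis by (auto simp: left_mass_def intro!: sum.cong)
qed

text \<open>
  The interval of a cylinder is cut into the intervals of its two children, that of the letter \<open>0\<close>
  on the left.
\<close>

lemma left_mass_child:
  "left_mass (Suc m) (x(m := 0)) = left_mass m x"
  "left_mass (Suc m) (x(m := 1)) = left_mass m x + len (Suc m) (x(m := 0))"
proof -
  have "left_mass m (x(m := a)) = left_mass m x" for a
    by (rule left_mass_cong) (simp add: cyl_def)
  then show "left_mass (Suc m) (x(m := 0)) = left_mass m x"
    "left_mass (Suc m) (x(m := 1)) = left_mass m x + len (Suc m) (x(m := 0))"
    by (simp_all add: left_mass_def)
qed

lemma interval_nested:
  "left_mass m x \<le> left_mass (Suc m) x"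
  "left_mass (Suc m) x + len (Suc m) x \<le> left_mass m x + len m x"
proof -
  have "left_mass m x \<le> left_mass (Suc m) x \<and>
    left_mass (Suc m) x + len (Suc m) x \<le> left_mass m x + len m x"
  proof (cases "x m = 0")
    case True
    then have "x(m := 0) = x" by auto
    then show ?thesis
      using left_mass_child(1)[of m x] len_split[of m x] len_nonneg[of "Suc m" "x(m := 1)"] by simp
  next
    case False
    then have "x(m := 1) = x" using letter_cases by fastforce
    then show ?thesis
      using left_mass_child(2)[of m x] len_split[of m x] len_nonneg[of "Suc m" "x(m := 0)"] by simp
  qed
  then show "left_mass m x \<le> left_mass (Suc m) x"
    "left_mass (Suc m) x + len (Suc m) x \<le> left_mass m x + len m x" by auto
qed

lemma lex_cdf_in_interval: "left_mass m x \<le> lex_cdf x" "lex_cdf x \<le> left_mass m x + len m x"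
proof -
  have mono: "incseq (\<lambda>m. left_mass m x)"
    and anti: "decseq (\<lambda>m. left_mass m x + len m x)"
    by (intro incseq_SucI decseq_SucI interval_nested)+
  have bound: "left_mass k x \<le> left_mass n x + len n x" for k n
  proof -
    have "left_mass k x \<le> left_mass (max k n) x" using mono by (simp add: incseq_def)
    also have "\<dots> \<le> left_mass (max k n) x + len (max k n) x" using len_nonneg by simp
    also have "\<dots> \<le> left_mass n x + len n x" using decseqD[OF anti, of n "max k n"] by simp
    finally show ?thesis .
  qed
  have "bdd_above (range (\<lambda>m. left_mass m x))" using bound[of _ 0] by (auto intro!: bdd_aboveI)
  then show "left_mass m x \<le> lex_cdf x" unfolding lex_cdf_def by (rule cSUP_upper[OF UNIV_I])
  show "lex_cdf x \<le> left_mass m x + len m x" unfolding lex_cdf_def by (rule cSUP_least) (auto intro: bound)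
qed

lemma lex_cdf_in_interval_cyl:
  assumes "y \<in> cyl x m"
  shows "lex_cdf y \<in> {left_mass m x .. left_mass m x + len m x}"
  using lex_cdf_in_interval[where m = m and x = y] left_mass_cong[OF assms] len_cong[OF assms] by auto

lemma lex_cdf_range: "lex_cdf x \<in> {0..1}"
  using lex_cdf_in_interval_cyl[of x x 0] by (simp add: left_mass_0 len_0)

text \<open>
  The only place where the absence of atoms enters: the cylinders around \<open>x\<close> shrink to \<open>{x}\<close>.
\<close>

lemma len_tendsto_0: "(\<lambda>m. len m x) \<longlonglongrightarrow> 0"
proof -
  have "(\<lambda>m. len m x) \<longlonglongrightarrow> prob (\<Inter>m. cyl x m)"
    unfolding len_def
    by (rule finite_Lim_measure_decseq) (auto simp: decseq_def intro: cyl_antimono[THEN subsetD])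
  moreover have "(\<Inter>m. cyl x m) = {x}" by (auto simp: cyl_def)
  ultimately show ?thesis by (simp add: atomless)
qed

lemma lex_cdf_prefix_continuous:
  assumes "\<epsilon> > 0"
  shows "\<exists>m. \<forall>y\<in>cyl x m. \<bar>lex_cdf y - lex_cdf x\<bar> < \<epsilon>"
proof -
  obtain m where "len m x < \<epsilon>"
    using order_tendstoD(2)[OF len_tendsto_0 assms] by (auto simp: eventually_sequentially)
  then have "\<bar>lex_cdf y - lex_cdf x\<bar> < \<epsilon>" if "y \<in> cyl x m" for y
    using lex_cdf_in_interval_cyl[OF that] lex_cdf_in_interval[where m = m and x = x] by auto
  then show ?thesis by blast
qed

lemma prefix_function_borel:
  fixes h :: "point \<Rightarrow> real"
  assumes "\<And>x y. y \<in> cyl x m \<Longrightarrow> h y = h x"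
  shows "h \<in> borel_measurable \<mu>"
  using prefix_function_measurable[of m h borel] assms by (simp cong: measurable_cong_sets add: sets_eq)

lemma left_mass_tendsto_cdf: "(\<lambda>m. left_mass m x) \<longlonglongrightarrow> lex_cdf x"
proof (rule tendsto_sandwich)
  show "(\<lambda>m. lex_cdf x - len m x) \<longlonglongrightarrow> lex_cdf x"
    using tendsto_diff[OF tendsto_const len_tendsto_0] by auto
  show "\<forall>\<^sub>F m in sequentially. lex_cdf x - len m x \<le> left_mass m x"
    "\<forall>\<^sub>F m in sequentially. left_mass m x \<le> lex_cdf x"
    using lex_cdf_in_interval by (simp_all add: algebra_simps)
qed (rule tendsto_const)

lemma lex_cdf_measurable [measurable]: "lex_cdf \<in> borel_measurable \<mu>"
  by (rule borel_measurable_LIMSEQ_real[OF left_mass_tendsto_cdf])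
    (rule prefix_function_borel, rule left_mass_cong)

text \<open>
  The difference quotient of \<open>\<Phi>\<close> over the interval of \<open>cyl x m\<close>. It is a step function
  approximating \<open>\<Phi>' \<circ> lex_cdf\<close>, and its integral telescopes.
\<close>

definition slope :: "(real \<Rightarrow> real) \<Rightarrow> nat \<Rightarrow> point \<Rightarrow> real" where
  "slope \<Phi> m x = (\<Phi> (left_mass m x + len m x) - \<Phi> (left_mass m x)) / len m x"

lemma slope_cong: "y \<in> cyl x m \<Longrightarrow> slope \<Phi> m y = slope \<Phi> m x"
  by (simp add: slope_def left_mass_cong len_cong)

lemma integrable_slope: "integrable \<mu> (slope \<Phi> m)"
proof -
  \<comment> \<open>The quotient depends on the prefix of length \<open>m\<close> only, so it takes finitely many values.\<close>
  have "finite (range (slope \<Phi> m))"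
  proof -
    have "slope \<Phi> m x = slope \<Phi> m (SOME y. y \<in> cyl x m)" for x
      using slope_cong someI[of "\<lambda>y. y \<in> cyl x m", OF mem_cyl] by metis
    then have "range (slope \<Phi> m) \<subseteq> (\<lambda>C. slope \<Phi> m (SOME y. y \<in> C)) ` range (\<lambda>x. cyl x m)"
      by (auto simp: image_iff) 
    then show ?thesis by (rule finite_subset) (rule finite_imageI[OF finite_cylinders])
  qed
  then have "bounded (range (slope \<Phi> m))" by (rule finite_imp_bounded)
  then obtain B where "\<And>x. norm (slope \<Phi> m x) \<le> B" by (auto simp: bounded_iff)
  then show ?thesis
    by (intro integrable_const_bound[where B = B] prefix_function_borel[OF slope_cong]) auto
qed

text \<open>
  Splitting the cylinder into its children telescopes the increments of \<open>\<Phi>\<close>, which makes the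
  integral independent of the level \<open>m + n\<close> at which the difference quotients are taken.
\<close>

lemma set_integral_slope:
  "(\<integral>y. indicator (cyl x m) y * slope \<Phi> (m + n) y \<partial>\<mu>)
     = \<Phi> (left_mass m x + len m x) - \<Phi> (left_mass m x)"
proof (induction n arbitrary: m x)
  case 0
  have "(\<lambda>y. indicator (cyl x m) y * slope \<Phi> m y) = (\<lambda>y. slope \<Phi> m x * indicator (cyl x m) y)"
    by (auto simp: indicator_def slope_cong fun_eq_iff)
  then have "(\<integral>y. indicator (cyl x m) y * slope \<Phi> (m + 0) y \<partial>\<mu>) = slope \<Phi> m x * len m x"
    by (simp add: len_def)
  then show ?case by (auto simp: slope_def)
next
  case (Suc n)
  let ?x = "\<lambda>a. x(m := a)"
  have int: "integrable \<mu> (\<lambda>y. indicator (cyl (?x a) (Suc m)) y * slope \<Phi> (Suc m + n) y)" for a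
    using integrable_mult_indicator[OF cyl_events integrable_slope] by simp
  have "(\<lambda>y. indicator (cyl x m) y * slope \<Phi> (m + Suc n) y) =
    (\<lambda>y. indicator (cyl (?x 0) (Suc m)) y * slope \<Phi> (Suc m + n) y
       + indicator (cyl (?x 1) (Suc m)) y * slope \<Phi> (Suc m + n) y)"
    using cyl_split[of x m] by (auto simp: fun_eq_iff indicator_def)
  then have "(\<integral>y. indicator (cyl x m) y * slope \<Phi> (m + Suc n) y \<partial>\<mu>)
    = (\<integral>y. indicator (cyl (?x 0) (Suc m)) y * slope \<Phi> (Suc m + n) y \<partial>\<mu>)
      + (\<integral>y. indicator (cyl (?x 1) (Suc m)) y * slope \<Phi> (Suc m + n) y \<partial>\<mu>)"
    using int by simp
  also have "\<dots> = \<Phi> (left_mass m x + len m x) - \<Phi> (left_mass m x)"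
    unfolding Suc.IH left_mass_child using len_split[of m x] by (simp add: add.assoc)
  finally show ?case .
qed

lemma integral_slope: "(\<integral>x. slope \<Phi> m x \<partial>\<mu>) = \<Phi> 1 - \<Phi> 0"
  using set_integral_slope[of undefined 0 \<Phi> m] by (simp add: left_mass_0 len_0)

lemma AE_len_pos: "AE x in \<mu>. \<forall>m. len m x > 0"
  unfolding AE_all_countable
proof
  fix m
  \<comment> \<open>Only finitely many cylinders of length \<open>m\<close> can have mass zero.\<close>
  have "AE x in \<mu>. \<forall>C\<in>{C \<in> range (\<lambda>x. cyl x m). prob C = 0}. x \<notin> C"
  proof (subst AE_ball_countable)
    show "countable {C \<in> range (\<lambda>x. cyl x m). prob C = 0}"
      by (rule countable_finite) (simp add: finite_cylinders)
    show "\<forall>C\<in>{C \<in> range (\<lambda>x. cyl x m). prob C = 0}. AE x in \<mu>. x \<notin> C"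
      by (auto intro!: AE_not_in simp: null_setsI emeasure_eq_measure)
  qed
  then show "AE x in \<mu>. len m x > 0"
  proof eventually_elim
    case (elim x)
    then have "prob (cyl x m) \<noteq> 0" using mem_cyl[of x m] by blast
    then show ?case by (simp add: len_def zero_less_measure_iff)
  qed
qed

text \<open>
  This is the statement that \<open>lex_cdf\<close> transports \<open>\<mu>\<close> to Lebesgue measure on \<open>[0,1]\<close>, with the
  integral of \<open>\<phi>\<close> over \<open>[0,1]\<close> written through its antiderivative \<open>\<Phi>\<close>. By the mean value theorem the
  difference quotients are values of \<open>\<phi>\<close> on intervals that shrink to \<open>lex_cdf x\<close>, so dominated
  convergence applies.
\<close>

lemma integral_cdf:
  assumes deriv: "\<And>t. (\<Phi> has_real_derivative \<phi> t) (at t)"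
    and cont: "continuous_on UNIV \<phi>" and bound: "\<And>t. \<bar>\<phi> t\<bar> \<le> B"
  shows "(\<integral>x. \<phi> (lex_cdf x) \<partial>\<mu>) = \<Phi> 1 - \<Phi> 0"
proof -
  have mvt: "\<exists>\<xi>. left_mass m x \<le> \<xi> \<and> \<xi> \<le> left_mass m x + len m x \<and> slope \<Phi> m x = \<phi> \<xi>"
    if "len m x > 0" for m x
  proof -
    have "left_mass m x < left_mass m x + len m x" using that by simp
    from MVT2[OF this, of \<Phi> \<phi>] deriv obtain \<xi> where
      "left_mass m x < \<xi>" "\<xi> < left_mass m x + len m x"
      "\<Phi> (left_mass m x + len m x) - \<Phi> (left_mass m x) = len m x * \<phi> \<xi>" by auto
    then show ?thesis using that by (intro exI[of _ \<xi>]) (auto simp: slope_def)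
  qed
  have "(\<lambda>m. \<integral>x. slope \<Phi> m x \<partial>\<mu>) \<longlonglongrightarrow> (\<integral>x. \<phi> (lex_cdf x) \<partial>\<mu>)"
  proof (rule integral_dominated_convergence[where w = "\<lambda>_. B"])
    have [measurable]: "\<phi> \<in> borel_measurable borel" using cont by (rule borel_measurable_continuous_onI)
    show "(\<lambda>x. \<phi> (lex_cdf x)) \<in> borel_measurable \<mu>" by measurable
    show "AE x in \<mu>. norm (slope \<Phi> m x) \<le> B" for m
      using AE_len_pos
    proof eventually_elim
      case (elim x) then show ?case using mvt[of m x] bound by force
    qed
    show "AE x in \<mu>. (\<lambda>m. slope \<Phi> m x) \<longlonglongrightarrow> \<phi> (lex_cdf x)"
      using AE_len_pos
    proof eventually_elim
      case (elim x)
      then have "\<forall>m. \<exists>\<xi>. left_mass m x \<le> \<xi> \<and> \<xi> \<le> left_mass m x + len m x \<and> slope \<Phi> m x = \<phi> \<xi>"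
        using mvt by blast
      from choice[OF this] obtain \<xi> where \<xi>: "\<And>m. left_mass m x \<le> \<xi> m" "\<And>m. \<xi> m \<le> left_mass m x + len m x"
        "\<And>m. slope \<Phi> m x = \<phi> (\<xi> m)"
        by blast
      have "\<xi> \<longlonglongrightarrow> lex_cdf x"
        by (rule tendsto_sandwich[OF _ _ left_mass_tendsto_cdf
            tendsto_add[OF left_mass_tendsto_cdf len_tendsto_0[of x], simplified]]) (simp_all add: \<xi>)
      then show ?case
        unfolding \<xi>(3) using cont by (intro isCont_tendsto_compose[of _ \<phi>]) (auto simp: continuous_on_eq_continuous_at)
    qed
  qed (auto intro: borel_measurable_integrable[OF integrable_slope])
  then show ?thesis unfolding integral_slope by (simp add: LIMSEQ_const_iff)
qed

text \<open>
  The bump \<open>1 / (1 + (K (s - t))\<^sup>2)\<close> is \<open>1\<close> at \<open>t\<close>, has an explicit antiderivative, and its integral is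
  at most \<open>\<pi> / K\<close>, which tends to \<open>0\<close> with growing \<open>K\<close>.
\<close>

lemma lex_cdf_fibre_null: "prob {x. lex_cdf x = t} = 0"
proof -
  have [measurable]: "{x. lex_cdf x = t} \<in> events"
    using measurable_sets[OF lex_cdf_measurable, of "{t}"] by (simp add: vimage_def)
  have "prob {x. lex_cdf x = t} \<le> pi / K" if "K > 0" for K :: real
  proof -
    let ?\<phi> = "\<lambda>s. 1 / (1 + (K * (s - t))\<^sup>2)"
    have pos: "1 + (K * (s - t))\<^sup>2 > 0" for s by (simp add: add_pos_nonneg)
    have bound: "\<bar>?\<phi> s\<bar> \<le> 1" for s using pos[of s] by (simp add: divide_simps)
    have cont: "continuous_on UNIV ?\<phi>"
      by (intro continuous_intros) (metis pos less_irrefl)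
    have meas [measurable]: "?\<phi> \<in> borel_measurable borel" by measurable
    have deriv: "((\<lambda>s. arctan (K * (s - t)) / K) has_real_derivative ?\<phi> s) (at s)" for s
      using that by (auto intro!: derivative_eq_intros simp: inverse_eq_divide)
    have "prob {x. lex_cdf x = t} = (\<integral>x. indicator {x. lex_cdf x = t} x \<partial>\<mu>)" by simp
    also have "\<dots> \<le> (\<integral>x. ?\<phi> (lex_cdf x) \<partial>\<mu>)"
    proof (rule integral_mono)
      show "integrable \<mu> (\<lambda>x. ?\<phi> (lex_cdf x))"
        using bound by (intro integrable_const_bound[where B = 1]) auto
      show "integrable \<mu> (indicat_real {x. lex_cdf x = t})"
        by (intro integrable_const_bound[where B = 1]) auto
    qed (use pos in \<open>auto simp: indicator_def less_imp_le\<close>)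
    also have "\<dots> = arctan (K * (1 - t)) / K - arctan (K * (0 - t)) / K"
      by (rule integral_cdf[OF deriv cont bound])
    also have "\<dots> \<le> pi / K"
    proof -
      have "arctan (K * (1 - t)) - arctan (K * (0 - t)) \<le> pi"
        using arctan_ubound[of "K * (1 - t)"] arctan_lbound[of "K * (0 - t)"] by linarith
      then show ?thesis using that by (simp add: diff_divide_distrib[symmetric] divide_right_mono)
    qed
    finally show ?thesis .
  qed
  then have "prob {x. lex_cdf x = t} \<le> pi / real (Suc n)" for n by simp
  moreover have "(\<lambda>n. pi / real (Suc n)) \<longlonglongrightarrow> 0"
    by (rule LIMSEQ_Suc[OF lim_const_over_n])
  ultimately have "prob {x. lex_cdf x = t} \<le> 0" by (intro LIMSEQ_le_const) auto
  then show ?thesis by (simp add: measure_le_0_iff)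
qed

definition cosine :: "nat \<Rightarrow> point \<Rightarrow> real" where
  "cosine n x = cos (real n * pi * lex_cdf x)"

lemma cosine_measurable [measurable]: "cosine n \<in> borel_measurable \<mu>"
  unfolding cosine_def[abs_def] by measurable

lemma abs_cosine_le_1: "\<bar>cosine n x\<bar> \<le> 1"
  by (simp add: cosine_def)

lemma integral_cos_cdf:
  fixes k :: int
  assumes "k \<noteq> 0"
  shows "(\<integral>x. cos (of_int k * pi * lex_cdf x) \<partial>\<mu>) = 0"
proof -
  have "(\<integral>x. cos (of_int k * pi * lex_cdf x) \<partial>\<mu>)
    = sin (of_int k * pi * 1) / (of_int k * pi) - sin (of_int k * pi * 0) / (of_int k * pi)"
    using assms
    by (intro integral_cdf[where \<Phi> = "\<lambda>t. sin (of_int k * pi * t) / (of_int k * pi)" and B = 1])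
      (auto intro!: derivative_eq_intros continuous_intros)
  then show ?thesis by (simp add: sin_times_pi_eq_0 mult.commute)
qed

lemma integral_cosine_product:
  "(\<integral>x. cosine m x * cosine n x \<partial>\<mu>) = (if m = n then if n = 0 then 1 else 1/2 else 0)"
proof -
  have int: "integrable \<mu> (\<lambda>x. cos (of_int k * pi * lex_cdf x))" for k :: int
    by (intro integrable_const_bound[where B = 1]) auto
  have 0: "(\<integral>x. cos (of_int k * pi * lex_cdf x) \<partial>\<mu>) = (if k = 0 then 1 else 0)" for k :: int
    using integral_cos_cdf[of k] prob_space by simp
  have product: "cosine m x * cosine n x = (cos (of_int (int m - int n) * pi * lex_cdf x)
      + cos (of_int (int m + int n) * pi * lex_cdf x)) / 2" for x
    unfolding cosine_def cos_times_cos by (simp add: algebra_simps)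
  have "(\<integral>x. cosine m x * cosine n x \<partial>\<mu>) =
     ((\<integral>x. cos (of_int (int m - int n) * pi * lex_cdf x) \<partial>\<mu>)
      + (\<integral>x. cos (of_int (int m + int n) * pi * lex_cdf x) \<partial>\<mu>)) / 2"
    unfolding product integral_divide_zero by (simp only: Bochner_Integration.integral_add[OF int int])
  then show ?thesis unfolding 0 by auto
qed

end

section \<open>Finite linear combinations and cosine polynomials\<close>

definition combinations :: "(nat \<Rightarrow> 'a \<Rightarrow> real) \<Rightarrow> ('a \<Rightarrow> real) set" where
  "combinations e = {f. \<exists>N c. f = (\<lambda>x. \<Sum>n<N. c n * e n x)}"

lemma combinationsI: "f = (\<lambda>x. \<Sum>n<N. c n * e n x) \<Longrightarrow> f \<in> combinations e"
  unfolding combinations_def by blast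

lemma combinations_zero: "(\<lambda>x. 0) \<in> combinations e"
  by (rule combinationsI[where N = 0]) simp

lemma combinations_basis: "e n \<in> combinations e"
proof -
  have "e n = (\<lambda>x. \<Sum>k<Suc n. (if k = n then 1 else 0) * e k x)"
    by (auto simp: fun_eq_iff if_distrib[of "\<lambda>a. a * _"] cong: if_cong)
  then show ?thesis by (rule combinationsI)
qed

lemma combinations_scale: "f \<in> combinations e \<Longrightarrow> (\<lambda>x. a * f x) \<in> combinations e"
proof -
  assume "f \<in> combinations e"
  then obtain N c where "f = (\<lambda>x. \<Sum>n<N. c n * e n x)" by (auto simp: combinations_def)
  then have "(\<lambda>x. a * f x) = (\<lambda>x. \<Sum>n<N. (a * c n) * e n x)"
    by (simp add: sum_distrib_left mult.assoc)
  then show ?thesis by (rule combinationsI)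
qed

lemma combinations_add:
  assumes "f \<in> combinations e" "g \<in> combinations e"
  shows "(\<lambda>x. f x + g x) \<in> combinations e"
proof -
  from assms obtain M c N d where f: "f = (\<lambda>x. \<Sum>n<M. c n * e n x)" and g: "g = (\<lambda>x. \<Sum>n<N. d n * e n x)"
    by (auto simp: combinations_def)
  \<comment> \<open>Zero coefficients bring both combinations to the common length \<open>M + N\<close>.\<close>
  have pad: "(\<Sum>n<K. c n * e n x) = (\<Sum>n<K + L. (if n < K then c n else 0) * e n x)" for K L :: nat and c :: "nat \<Rightarrow> real" and x
    by (rule sum.mono_neutral_cong_left) auto
  have "(\<lambda>x. f x + g x) =
    (\<lambda>x. \<Sum>n<M + N. ((if n < M then c n else 0) + (if n < N then d n else 0)) * e n x)"
    unfolding f g pad[where K = M and c = c and L = N] pad[where K = N and c = d and L = M] by (simp add: add.commute sum.distrib distrib_right)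
  then show ?thesis by (rule combinationsI)
qed

lemma combinations_sum:
  assumes "\<And>i. i \<in> I \<Longrightarrow> f i \<in> combinations e"
  shows "(\<lambda>x. \<Sum>i\<in>I. f i x) \<in> combinations e"
  using assms
  by (induction I rule: infinite_finite_induct) (auto simp: combinations_zero intro: combinations_add)

lemma combinations_mult:
  assumes "\<And>m n. (\<lambda>x. e m x * e n x) \<in> combinations e"
    and "f \<in> combinations e" "g \<in> combinations e"
  shows "(\<lambda>x. f x * g x) \<in> combinations e"
proof -
  from assms obtain M c N d where f: "f = (\<lambda>x. \<Sum>n<M. c n * e n x)" and g: "g = (\<lambda>x. \<Sum>n<N. d n * e n x)"
    by (auto simp: combinations_def)
  have "(\<lambda>x. f x * g x) = (\<lambda>x. \<Sum>m<M. \<Sum>n<N. (c m * d n) * (e m x * e n x))"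
    unfolding f g by (simp add: sum_product mult_ac)
  then show ?thesis by (auto intro!: combinations_sum combinations_scale assms(1))
qed

text \<open>
  The addition theorem makes the cosine polynomials an algebra, and \<open>cos (\<pi> t)\<close> separates the points
  of \<open>[0,1]\<close>.
\<close>

lemma cosine_combinations_dense:
  assumes "continuous_on {0..1} \<phi>" "\<epsilon> > 0"
  shows "\<exists>g\<in>combinations (\<lambda>n t. cos (real n * pi * t)). \<forall>t\<in>{0..1}. \<bar>\<phi> t - g t\<bar> < \<epsilon>"
proof -
  let ?e = "\<lambda>n t. cos (real n * pi * t)"
  have product: "(\<lambda>t. ?e m t * ?e n t) \<in> combinations ?e" for m n
  proof -
    have "?e m t * ?e n t = (1/2) * ?e (nat \<bar>int m - int n\<bar>) t + (1/2) * ?e (m + n) t" for t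
    proof -
      have "cos (real (nat \<bar>int m - int n\<bar>) * pi * t) = cos (real m * pi * t - real n * pi * t)"
      proof (cases "n \<le> m")
        case True
        then show ?thesis by (simp add: of_nat_diff nat_diff_distrib algebra_simps)
      next
        case False
        then have "real (nat \<bar>int m - int n\<bar>) * pi * t = - (real m * pi * t - real n * pi * t)"
          by (simp add: algebra_simps)
        then show ?thesis by (simp only: cos_minus)
      qed
      then show ?thesis by (simp add: cos_times_cos algebra_simps add_divide_distrib)
    qed
    then show ?thesis
      by (simp only:) (intro combinations_add combinations_scale combinations_basis)
  qed
  interpret function_ring_on "combinations ?e" "{0..1}"
  proof
    show "continuous_on {0..1} f" if "f \<in> combinations ?e" for f
      using that by (auto simp: combinations_def intro!: continuous_intros)
    show "(\<lambda>_. c) \<in> combinations ?e" for c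
      using combinations_scale[OF combinations_basis[of ?e 0], of c] by simp
    fix s t :: real assume st: "s \<in> {0..1}" "t \<in> {0..1}" "s \<noteq> t"
    have "cos (pi * s) \<noteq> cos (pi * t)"
      using st cos_inj_pi[of "pi * s" "pi * t"] by (auto simp: mult_le_cancel_left1)
    then show "\<exists>f\<in>combinations ?e. f s \<noteq> f t"
      using combinations_basis[of ?e 1] by (intro bexI[of _ "?e 1"]) auto
  qed (auto intro: combinations_add combinations_mult product)
  show ?thesis using Stone_Weierstrass_basic[OF assms] .
qed

section \<open>Closed spans in the space of square integrable functions\<close>

lemma l2_integrable_mult:
  assumes "f \<in> l2_functions \<mu>" "g \<in> l2_functions \<mu>"
  shows "integrable \<mu> (\<lambda>x. f x * g x)"
proof (rule Bochner_Integration.integrable_bound)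
  show "integrable \<mu> (\<lambda>x. (f x)\<^sup>2 + (g x)\<^sup>2)" using assms by (simp add: l2_functions_def)
  show "(\<lambda>x. f x * g x) \<in> borel_measurable \<mu>" using assms by (auto simp: l2_functions_def)
  have "\<bar>a * b\<bar> \<le> a\<^sup>2 + b\<^sup>2" for a b :: real
  proof -
    have "2 * (\<bar>a\<bar> * \<bar>b\<bar>) \<le> a\<^sup>2 + b\<^sup>2" using sum_squares_bound[of "\<bar>a\<bar>" "\<bar>b\<bar>"] by simp
    moreover have "0 \<le> \<bar>a\<bar> * \<bar>b\<bar>" by simp
    ultimately show ?thesis unfolding abs_mult by linarith
  qed
  then show "AE x in \<mu>. norm (f x * g x) \<le> norm ((f x)\<^sup>2 + (g x)\<^sup>2)" by simp
qed

lemma l2_scale: "f \<in> l2_functions \<mu> \<Longrightarrow> (\<lambda>x. a * f x) \<in> l2_functions \<mu>"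
  by (auto simp: l2_functions_def power_mult_distrib)

lemma l2_add:
  assumes "f \<in> l2_functions \<mu>" "g \<in> l2_functions \<mu>"
  shows "(\<lambda>x. f x + g x) \<in> l2_functions \<mu>"
  using assms l2_integrable_mult[OF assms]
  by (auto simp: l2_functions_def power2_sum mult.assoc)

lemma l2_diff:
  assumes "f \<in> l2_functions \<mu>" "g \<in> l2_functions \<mu>"
  shows "(\<lambda>x. f x - g x) \<in> l2_functions \<mu>"
  using l2_add[OF assms(1) l2_scale[OF assms(2), of "-1"]] by simp

lemma l2_zero: "(\<lambda>x. 0) \<in> l2_functions \<mu>"
  by (simp add: l2_functions_def)

lemma l2_sum:
  "(\<And>i. i \<in> I \<Longrightarrow> f i \<in> l2_functions \<mu>) \<Longrightarrow> (\<lambda>x. \<Sum>i\<in>I. f i x) \<in> l2_functions \<mu>"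
  by (induction I rule: infinite_finite_induct) (auto simp: l2_zero intro: l2_add)

lemma l2_dominated:
  assumes "w \<in> l2_functions \<mu>" "f \<in> borel_measurable \<mu>" "AE x in \<mu>. \<bar>f x\<bar> \<le> w x"
  shows "f \<in> l2_functions \<mu>"
proof -
  have "integrable \<mu> (\<lambda>x. (f x)\<^sup>2)"
  proof (rule Bochner_Integration.integrable_bound)
    show "integrable \<mu> (\<lambda>x. (w x)\<^sup>2)" using assms by (simp add: l2_functions_def)
    show "AE x in \<mu>. norm ((f x)\<^sup>2) \<le> norm ((w x)\<^sup>2)"
      using assms(3)
    proof eventually_elim
      case (elim x) then show ?case using power_mono[of "\<bar>f x\<bar>" "w x" 2] by simp
    qed
  qed (use assms in auto)
  then show ?thesis using assms by (simp add: l2_functions_def)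
qed

lemma bounded_l2:
  assumes "finite_measure \<mu>" "g \<in> borel_measurable \<mu>" "\<And>x. \<bar>g x\<bar> \<le> B"
  shows "g \<in> l2_functions \<mu>"
proof (rule l2_dominated)
  interpret finite_measure \<mu> by fact
  show "(\<lambda>_. B) \<in> l2_functions \<mu>" by (simp add: l2_functions_def)
qed (use assms in auto)

lemma l2_combination:
  "(\<And>n. e n \<in> l2_functions \<mu>) \<Longrightarrow> f \<in> combinations e \<Longrightarrow> f \<in> l2_functions \<mu>"
  by (auto simp: combinations_def intro!: l2_sum l2_scale)

text \<open>
  A substitute for the triangle inequality that avoids square roots; it rests on
  \<open>(a + b)\<^sup>2 \<le> 2 a\<^sup>2 + 2 b\<^sup>2\<close>.
\<close>

lemma square_integral_triangle:
  assumes "f \<in> l2_functions \<mu>" "h \<in> l2_functions \<mu>" "g \<in> l2_functions \<mu>"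
  shows "(\<integral>x. (f x - g x)\<^sup>2 \<partial>\<mu>) \<le> 2 * (\<integral>x. (f x - h x)\<^sup>2 \<partial>\<mu>) + 2 * (\<integral>x. (h x - g x)\<^sup>2 \<partial>\<mu>)"
proof -
  have int: "integrable \<mu> (\<lambda>x. (u x - v x)\<^sup>2)" if "u \<in> l2_functions \<mu>" "v \<in> l2_functions \<mu>" for u v
    using l2_diff[OF that] by (simp add: l2_functions_def)
  have "(\<integral>x. (f x - g x)\<^sup>2 \<partial>\<mu>) \<le> (\<integral>x. 2 * (f x - h x)\<^sup>2 + 2 * (h x - g x)\<^sup>2 \<partial>\<mu>)"
  proof (rule integral_mono)
    fix x
    have "2 * (f x - h x)\<^sup>2 + 2 * (h x - g x)\<^sup>2 - (f x - g x)\<^sup>2 = ((f x - h x) - (h x - g x))\<^sup>2"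
      by (simp add: power2_eq_square algebra_simps)
    then show "(f x - g x)\<^sup>2 \<le> 2 * (f x - h x)\<^sup>2 + 2 * (h x - g x)\<^sup>2"
      using zero_le_power2 by (metis diff_ge_0_iff_ge)
  qed (use int assms in auto)
  also have "\<dots> = 2 * (\<integral>x. (f x - h x)\<^sup>2 \<partial>\<mu>) + 2 * (\<integral>x. (h x - g x)\<^sup>2 \<partial>\<mu>)"
    using int[OF assms(1,2)] int[OF assms(2,3)] by simp
  finally show ?thesis .
qed

locale l2_system =
  fixes \<mu> :: "point measure" and e :: "nat \<Rightarrow> point \<Rightarrow> real"
  assumes e_l2: "e n \<in> l2_functions \<mu>"
begin

definition closed_span :: "(point \<Rightarrow> real) set" where
  "closed_span = {f \<in> l2_functions \<mu>. \<forall>\<epsilon>>0. \<exists>g\<in>combinations e. (\<integral>x. (f x - g x)\<^sup>2 \<partial>\<mu>) < \<epsilon>}"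

lemma closed_span_l2: "f \<in> closed_span \<Longrightarrow> f \<in> l2_functions \<mu>"
  by (simp add: closed_span_def)

lemma combination_in_closed_span: "f \<in> combinations e \<Longrightarrow> f \<in> closed_span"
  by (auto simp: closed_span_def intro!: bexI[of _ f] l2_combination[OF e_l2])

lemma closed_span_closed:
  assumes f: "f \<in> l2_functions \<mu>"
    and approx: "\<And>\<epsilon>. \<epsilon> > 0 \<Longrightarrow> \<exists>h\<in>closed_span. (\<integral>x. (f x - h x)\<^sup>2 \<partial>\<mu>) < \<epsilon>"
  shows "f \<in> closed_span"
  unfolding closed_span_def
proof (intro CollectI conjI allI impI f)
  fix \<epsilon> :: real assume "\<epsilon> > 0"
  then obtain h where h: "h \<in> closed_span" "(\<integral>x. (f x - h x)\<^sup>2 \<partial>\<mu>) < \<epsilon> / 4"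
    using approx[of "\<epsilon> / 4"] by auto
  then obtain g where g: "g \<in> combinations e" "(\<integral>x. (h x - g x)\<^sup>2 \<partial>\<mu>) < \<epsilon> / 4"
    using \<open>\<epsilon> > 0\<close> by (auto simp: closed_span_def dest: spec[of _ "\<epsilon> / 4"])
  have "(\<integral>x. (f x - g x)\<^sup>2 \<partial>\<mu>) < \<epsilon>"
    using square_integral_triangle[OF f closed_span_l2[OF h(1)] l2_combination[OF e_l2 g(1)]] h(2) g(2)
    by linarith
  then show "\<exists>g\<in>combinations e. (\<integral>x. (f x - g x)\<^sup>2 \<partial>\<mu>) < \<epsilon>" using g(1) by blast
qed

lemma closed_span_scale:
  assumes "f \<in> closed_span"
  shows "(\<lambda>x. a * f x) \<in> closed_span"
proof (cases "a = 0")
  case True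
  then show ?thesis using combination_in_closed_span[OF combinations_zero] by simp
next
  case False
  show ?thesis
    unfolding closed_span_def
  proof (intro CollectI conjI allI impI l2_scale closed_span_l2 assms)
    fix \<epsilon> :: real assume "\<epsilon> > 0"
    then obtain g where g: "g \<in> combinations e" "(\<integral>x. (f x - g x)\<^sup>2 \<partial>\<mu>) < \<epsilon> / a\<^sup>2"
      using assms False by (auto simp: closed_span_def dest: spec[of _ "\<epsilon> / a\<^sup>2"])
    have "(\<integral>x. (a * f x - a * g x)\<^sup>2 \<partial>\<mu>) = a\<^sup>2 * (\<integral>x. (f x - g x)\<^sup>2 \<partial>\<mu>)"
      by (simp flip: right_diff_distrib add: power_mult_distrib)
    also have "\<dots> < \<epsilon>" using g(2) False by (simp add: field_simps)
    finally show "\<exists>g\<in>combinations e. (\<integral>x. (a * f x - g x)\<^sup>2 \<partial>\<mu>) < \<epsilon>"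
      using combinations_scale[OF g(1), of a] by (intro bexI) auto
  qed
qed

lemma closed_span_add:
  assumes f: "f \<in> closed_span" and g: "g \<in> closed_span"
  shows "(\<lambda>x. f x + g x) \<in> closed_span"
  unfolding closed_span_def
proof (intro CollectI conjI allI impI l2_add closed_span_l2 f g)
  fix \<epsilon> :: real assume "\<epsilon> > 0"
  then have "\<epsilon> / 4 > 0" by simp
  then obtain u v where u: "u \<in> combinations e" "(\<integral>x. (f x - u x)\<^sup>2 \<partial>\<mu>) < \<epsilon> / 4"
    and v: "v \<in> combinations e" "(\<integral>x. (g x - v x)\<^sup>2 \<partial>\<mu>) < \<epsilon> / 4"
    using f g unfolding closed_span_def by blast
  have "(\<integral>x. ((f x + g x) - (u x + v x))\<^sup>2 \<partial>\<mu>) \<le>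
      2 * (\<integral>x. ((f x + g x) - (u x + g x))\<^sup>2 \<partial>\<mu>) + 2 * (\<integral>x. ((u x + g x) - (u x + v x))\<^sup>2 \<partial>\<mu>)"
    by (intro square_integral_triangle l2_add closed_span_l2[OF f] closed_span_l2[OF g]
        l2_combination[OF e_l2 u(1)] l2_combination[OF e_l2 v(1)])
  also have "\<dots> < \<epsilon>" using u(2) v(2) by simp
  finally show "\<exists>w\<in>combinations e. (\<integral>x. (f x + g x - w x)\<^sup>2 \<partial>\<mu>) < \<epsilon>"
    using combinations_add[OF u(1) v(1)] by (intro bexI) auto
qed

lemma closed_span_limit:
  assumes h: "\<And>j. h j \<in> closed_span" and w: "w \<in> l2_functions \<mu>"
    and f: "f \<in> borel_measurable \<mu>"
    and lim: "AE x in \<mu>. (\<lambda>j. h j x) \<longlonglongrightarrow> f x"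
    and dom: "\<And>j. AE x in \<mu>. \<bar>h j x\<bar> \<le> w x"
  shows "f \<in> closed_span"
proof (rule closed_span_closed)
  have meas [measurable]: "h j \<in> borel_measurable \<mu>" "f \<in> borel_measurable \<mu>" for j
    using closed_span_l2[OF h] f by (auto simp: l2_functions_def)
  have dom': "AE x in \<mu>. \<forall>j. \<bar>h j x\<bar> \<le> w x"
    using dom by (simp add: AE_all_countable)
  have fw: "AE x in \<mu>. \<bar>f x\<bar> \<le> w x"
    using dom' lim
  proof eventually_elim
    case (elim x)
    show ?case
      by (rule LIMSEQ_le_const2[OF tendsto_rabs[OF elim(2)]]) (use elim(1) in auto)
  qed
  show "f \<in> l2_functions \<mu>" by (rule l2_dominated[OF w f fw])
  have "(\<lambda>j. \<integral>x. (f x - h j x)\<^sup>2 \<partial>\<mu>) \<longlonglongrightarrow> (\<integral>x. 0 \<partial>\<mu>)"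
  proof (rule integral_dominated_convergence[where w = "\<lambda>x. 4 * (w x)\<^sup>2"])
    show "integrable \<mu> (\<lambda>x. 4 * (w x)\<^sup>2)" using w by (simp add: l2_functions_def)
    show "AE x in \<mu>. (\<lambda>j. (f x - h j x)\<^sup>2) \<longlonglongrightarrow> 0"
      using lim
    proof eventually_elim
      case (elim x)
      show ?case using tendsto_power[OF tendsto_diff[OF tendsto_const elim], of "f x" 2] by simp
    qed
    show "AE x in \<mu>. norm ((f x - h j x)\<^sup>2) \<le> 4 * (w x)\<^sup>2" for j
      using fw dom[of j]
    proof eventually_elim
      case (elim x)
      then have "\<bar>f x - h j x\<bar> \<le> 2 * w x" by linarith
      from power_mono[OF this, of 2] show ?case by (simp add: power_mult_distrib)
    qed
  qed measurable
  then have error: "(\<lambda>j. \<integral>x. (f x - h j x)\<^sup>2 \<partial>\<mu>) \<longlonglongrightarrow> 0" by simp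
  fix \<epsilon> :: real assume "\<epsilon> > 0"
  from order_tendstoD(2)[OF error this] obtain j where "(\<integral>x. (f x - h j x)\<^sup>2 \<partial>\<mu>) < \<epsilon>"
    by (auto simp: eventually_sequentially)
  then show "\<exists>g\<in>closed_span. (\<integral>x. (f x - g x)\<^sup>2 \<partial>\<mu>) < \<epsilon>" using h by blast
qed

text \<open>
  Cylinders pass to all events because the events with indicator in the closed span form a Dynkin
  system. Events pass to nonnegative functions by monotone limits, which are dominated by the limit,
  and these to all functions by the decomposition into positive and negative part.
\<close>

lemma closed_span_all:
  assumes "prob_space \<mu>" and sets: "sets \<mu> = sets M_algebra"
    and cylinder: "\<And>x m. indicator (cyl x m) \<in> closed_span" and f: "f \<in> l2_functions \<mu>"
  shows "f \<in> closed_span"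
proof -
  interpret prob_space \<mu> by fact
  have space: "space \<mu> = UNIV" using sets_eq_imp_space_eq[OF sets] by simp
  have event: "indicat_real B \<in> closed_span" if "B \<in> events" for B
  proof -
    have sub: "long_cylinders 0 \<subseteq> Pow UNIV" by simp
    have "B \<in> sigma_sets UNIV (long_cylinders 0)"
      using that by (simp add: sets flip: sets_M_algebra_cylinders)
    from Int_stable_long_cylinders sub this show ?thesis
    proof (induction rule: sigma_sets_induct_disjoint)
      case (basic B)
      then show ?case
        using cylinder combination_in_closed_span[OF combinations_zero]
        by (auto simp: long_cylinders_def indicator_def[abs_def])
    next
      case empty
      then show ?case using combination_in_closed_span[OF combinations_zero] by simp
    next
      case (compl B)
      have "(indicator (UNIV - B) :: point \<Rightarrow> real) = (\<lambda>x. indicator (cyl undefined 0) x + (-1) * indicator B x)"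
        by (auto simp: indicator_def)
      then show ?case
        using closed_span_add[OF cylinder closed_span_scale[OF compl(2), of "-1"]] by (simp only:)
    next
      case (union B)
      have B: "B i \<in> events" for i
        using union.hyps(2) by (auto simp: sets sets_M_algebra_cylinders[of 0])
      have partial: "(\<lambda>x. \<Sum>i<n. indicat_real (B i) x) \<in> closed_span" for n
      proof (induction n)
        case 0
        then show ?case using combination_in_closed_span[OF combinations_zero] by simp
      next
        case (Suc n)
        then show ?case using closed_span_add[OF Suc union.IH[of n]] by simp
      qed
      have eq: "(\<Sum>i<n. indicat_real (B i) x) = indicator (\<Union>i<n. B i) x" for n x
        using union.hyps(1)
        by (subst indicator_UN_disjoint) (auto intro: disjoint_family_on_mono)
      show ?case
      proof (rule closed_span_limit[OF partial, where w = "\<lambda>_. 1"])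
        show "AE x in \<mu>. (\<lambda>n. \<Sum>i<n. indicat_real (B i) x) \<longlonglongrightarrow> indicator (\<Union>i. B i) x"
          unfolding eq by (intro AE_I2 LIMSEQ_indicator_UN)
        show "AE x in \<mu>. \<bar>\<Sum>i<n. indicat_real (B i) x\<bar> \<le> 1" for n
          unfolding eq by (simp add: indicator_def)
      qed (use B in \<open>auto simp: l2_functions_def\<close>)
    qed
  qed
  have nonneg: "g \<in> l2_functions \<mu> \<longrightarrow> g \<in> closed_span"
    if "g \<in> borel_measurable \<mu>" "\<And>x. 0 \<le> g x" for g
    using that
  proof (induction rule: borel_measurable_induct_real)
    case (set A)
    then show ?case using event by simp
  next
    case (mult u c)
    show ?case
    proof (cases "c = 0")
      case True
      then show ?thesis using combination_in_closed_span[OF combinations_zero] by simp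
    next
      case False
      show ?thesis
      proof
        assume "(\<lambda>x. c * u x) \<in> l2_functions \<mu>"
        from l2_scale[OF this, of "1 / c"] have "u \<in> closed_span" using False mult by simp
        then show "(\<lambda>x. c * u x) \<in> closed_span" by (rule closed_span_scale)
      qed
    qed
  next
    case (add u v)
    show ?case
    proof
      assume uv: "(\<lambda>x. v x + u x) \<in> l2_functions \<mu>"
      have "u \<in> l2_functions \<mu>" "v \<in> l2_functions \<mu>"
        using add by (auto intro!: l2_dominated[OF uv])
      then show "(\<lambda>x. v x + u x) \<in> closed_span" using add by (intro closed_span_add) auto
    qed
  next
    case (seq U)
    have mono: "incseq U" and lim: "(\<lambda>i. U i x) \<longlonglongrightarrow> g x" and pos: "0 \<le> U i x"
      and meas: "U i \<in> borel_measurable \<mu>" and gm: "g \<in> borel_measurable \<mu>" for i x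
      using seq space that(1) by auto
    have le: "U i x \<le> g x" for i x
      using mono by (intro incseq_le[OF _ lim]) (auto simp: incseq_def le_fun_def)
    show ?case
    proof
      assume g: "g \<in> l2_functions \<mu>"
      have "U i \<in> l2_functions \<mu>" for i
        by (rule l2_dominated[OF g meas]) (simp add: pos le)
      then have U: "U i \<in> closed_span" for i using seq by blast
      show "g \<in> closed_span"
        by (rule closed_span_limit[where h = U, OF U g gm]) (simp_all add: lim pos le)
    qed
  qed
  have fm: "f \<in> borel_measurable \<mu>" using f by (simp add: l2_functions_def)
  have absf: "(\<lambda>x. \<bar>f x\<bar>) \<in> l2_functions \<mu>" using f by (auto simp add: l2_functions_def)
  have "(\<lambda>x. max 0 (f x)) \<in> closed_span"
    using nonneg[of "\<lambda>x. max 0 (f x)"] l2_dominated[OF absf, of "\<lambda>x. max 0 (f x)"] fm by simp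
  moreover have "(\<lambda>x. max 0 (- f x)) \<in> closed_span"
    using nonneg[of "\<lambda>x. max 0 (- f x)"] l2_dominated[OF absf, of "\<lambda>x. max 0 (- f x)"] fm by simp
  ultimately have "(\<lambda>x. max 0 (f x) + (-1) * max 0 (- f x)) \<in> closed_span"
    by (intro closed_span_add closed_span_scale)
  moreover have "(\<lambda>x. max 0 (f x) + (-1) * max 0 (- f x)) = f" by (auto simp: fun_eq_iff)
  ultimately show ?thesis by simp
qed

end

section \<open>Completeness of the cosines of the distribution function\<close>

context atomless_cantor
begin

sublocale cosines: l2_system \<mu> cosine
  by unfold_locales (rule bounded_l2[OF finite_measure_axioms cosine_measurable abs_cosine_le_1])

lemma continuous_of_cdf_in_span:
  assumes cont: "continuous_on UNIV \<phi>"
  shows "(\<lambda>x. \<phi> (lex_cdf x)) \<in> cosines.closed_span"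
proof -
  have cont01: "continuous_on {0..1} \<phi>" using cont by (rule continuous_on_subset) simp
  have [measurable]: "\<phi> \<in> borel_measurable borel" using cont by (rule borel_measurable_continuous_onI)
  obtain B where B: "\<forall>t\<in>{0..1}. \<bar>\<phi> t\<bar> \<le> B"
    using compact_imp_bounded[OF compact_continuous_image[OF cont01]] by (auto simp: bounded_iff)
  have l2: "(\<lambda>x. \<phi> (lex_cdf x)) \<in> l2_functions \<mu>"
    by (rule bounded_l2[OF finite_measure_axioms, of _ B]) (use lex_cdf_range B in auto)
  show ?thesis
    unfolding cosines.closed_span_def
  proof (intro CollectI conjI allI impI l2)
    fix \<epsilon> :: real assume "\<epsilon> > 0"
    \<comment> \<open>The square of a uniform error \<open>\<delta>\<close> has integral at most \<open>\<delta>\<^sup>2 = \<epsilon> / 2\<close>.\<close>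
    define \<delta> where "\<delta> = sqrt (\<epsilon> / 2)"
    have "\<delta> > 0" using \<open>\<epsilon> > 0\<close> by (simp add: \<delta>_def)
    then obtain g where g: "g \<in> combinations (\<lambda>n t. cos (real n * pi * t))"
      and close: "\<And>t. t \<in> {0..1} \<Longrightarrow> \<bar>\<phi> t - g t\<bar> < \<delta>"
      using cosine_combinations_dense[OF cont01] by blast
    from g obtain N c where g_eq: "g = (\<lambda>t. \<Sum>n<N. c n * cos (real n * pi * t))"
      by (auto simp: combinations_def)
    have comb: "(\<lambda>x. g (lex_cdf x)) \<in> combinations cosine"
      unfolding g_eq combinations_def cosine_def by blast
    have gl2: "(\<lambda>x. g (lex_cdf x)) \<in> l2_functions \<mu>"
      using l2_combination[OF cosines.e_l2 comb] .
    have "(\<integral>x. (\<phi> (lex_cdf x) - g (lex_cdf x))\<^sup>2 \<partial>\<mu>) \<le> (\<integral>x. \<delta>\<^sup>2 \<partial>\<mu>)"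
    proof (rule integral_mono)
      show "integrable \<mu> (\<lambda>x. (\<phi> (lex_cdf x) - g (lex_cdf x))\<^sup>2)"
        using l2_diff[OF l2 gl2] by (simp add: l2_functions_def)
      show "(\<phi> (lex_cdf x) - g (lex_cdf x))\<^sup>2 \<le> \<delta>\<^sup>2" for x
        using power_mono[OF less_imp_le[OF close[OF lex_cdf_range[of x]]], of 2] by simp
    qed simp
    also have "\<dots> < \<epsilon>" using prob_space \<open>\<epsilon> > 0\<close> by (simp add: \<delta>_def)
    finally show "\<exists>g\<in>combinations cosine. (\<integral>x. (\<phi> (lex_cdf x) - g x)\<^sup>2 \<partial>\<mu>) < \<epsilon>"
      using comb by (rule bexI)
  qed
qed

text \<open>
  The intervals of different cylinders of the same length meet at most in endpoints, so \<open>lex_cdf\<close>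
  of a point determines the cylinder unless it is an endpoint.
\<close>

lemma lex_cdf_outside_cylinder:
  assumes "y \<notin> cyl x m"
  shows "lex_cdf y \<le> left_mass m x \<or> left_mass m x + len m x \<le> lex_cdf y"
  using assms
proof (induction m)
  case (Suc m)
  show ?case
  proof (cases "y \<in> cyl x m")
    case False
    then show ?thesis using Suc.IH interval_nested[of m x] by linarith
  next
    case True
    then have neq: "y m \<noteq> x m" using Suc.prems by (auto simp: cyl_def less_Suc_eq)
    have child: "y(m := a) \<in> cyl (x(m := a)) (Suc m)" for a
      using True by (auto simp: cyl_def less_Suc_eq)
    show ?thesis
    proof (cases "x m = 0")
      case True
      then have "y m = 1" using neq letter_cases by metis
      with True have [simp]: "x(m := 0) = x" "y(m := 1) = y" by auto
      show ?thesis
        using child[of 1] lex_cdf_in_interval_cyl[of y "x(m := 1)" "Suc m"] left_mass_child[of m x] by auto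
    next
      case False
      then have "x m = 1" "y m = 0" using neq letter_cases by metis+
      then have [simp]: "x(m := 1) = x" "y(m := 0) = y" by auto
      show ?thesis
        using child[of 0] lex_cdf_in_interval_cyl[of y "x(m := 0)" "Suc m"] left_mass_child[of m x] by auto
    qed
  qed
qed simp

lemma AE_cdf_neq: "AE x in \<mu>. lex_cdf x \<noteq> t"
proof -
  have "{x. lex_cdf x = t} \<in> events"
    using measurable_sets[OF lex_cdf_measurable, of "{t}"] by (simp add: vimage_def)
  then have "{x. lex_cdf x = t} \<in> null_sets \<mu>"
    by (auto simp: emeasure_eq_measure lex_cdf_fibre_null intro: null_setsI)
  from AE_not_in[OF this] show ?thesis by simp
qed

text \<open>
  Away from the null set where \<open>lex_cdf\<close> hits an endpoint, the indicator of a cylinder is the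
  indicator of an open interval evaluated at \<open>lex_cdf\<close>; the trapezoids \<open>\<phi> j\<close> increase to the latter.
\<close>

lemma cylinder_in_span: "indicator (cyl x m) \<in> cosines.closed_span"
proof -
  define a b where "a = left_mass m x" and "b = left_mass m x + len m x"
  define \<phi> where "\<phi> = (\<lambda>(j::nat) t. min 1 (real j * max 0 (min (t - a) (b - t))))"
  show ?thesis
  proof (rule cosines.closed_span_limit[where h = "\<lambda>j y. \<phi> j (lex_cdf y)" and w = "\<lambda>_. 1"])
    show "(\<lambda>y. \<phi> j (lex_cdf y)) \<in> cosines.closed_span" for j
      unfolding \<phi>_def by (rule continuous_of_cdf_in_span) (intro continuous_intros)
    show "AE y in \<mu>. (\<lambda>j. \<phi> j (lex_cdf y)) \<longlonglongrightarrow> indicator (cyl x m) y"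
      using AE_cdf_neq[of a] AE_cdf_neq[of b]
    proof eventually_elim
      case (elim y)
      show ?case
      proof (cases "y \<in> cyl x m")
        case True
        define d where "d = min (lex_cdf y - a) (b - lex_cdf y)"
        have "d > 0" using elim lex_cdf_in_interval_cyl[OF True] by (auto simp: a_def b_def d_def)
        then obtain N where N: "1 < real N * d" using reals_Archimedean3 by blast
        have "\<phi> j (lex_cdf y) = 1" if "N \<le> j" for j
        proof -
          have "real N * d \<le> real j * d" using that \<open>d > 0\<close> by (intro mult_right_mono) auto
          then have "1 \<le> real j * d" using N by linarith
          then have "1 \<le> real j * max 0 d" using \<open>d > 0\<close> by (simp add: max_def)
          then show ?thesis by (simp add: \<phi>_def d_def)
        qed
        then show ?thesis using True by (intro tendsto_eventually) (auto simp: eventually_sequentially)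
      next
        case False
        then have "max 0 (min (lex_cdf y - a) (b - lex_cdf y)) = 0"
          using lex_cdf_outside_cylinder[OF False] by (auto simp: a_def b_def)
        then show ?thesis using False by (simp add: \<phi>_def)
      qed
    qed
    show "AE y in \<mu>. \<bar>\<phi> j (lex_cdf y)\<bar> \<le> 1" for j
      by (simp add: \<phi>_def)
  qed (auto simp: l2_functions_def)
qed

lemma cosine_complete: "f \<in> l2_functions \<mu> \<Longrightarrow> f \<in> cosines.closed_span"
  by (rule cosines.closed_span_all[OF prob_space_axioms sets_eq cylinder_in_span])

end

section \<open>The Markov measure and its transfer operator\<close>

lemma shift_case_nat [simp]: "shift (case_nat a x) = x"
  by (simp add: shift_def)

lemma shift_measurable [measurable]: "shift \<in> measurable M_algebra M_algebra"
  unfolding shift_def[abs_def] M_algebra_def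
  by (rule measurable_PiM_single') (auto intro: measurable_component_singleton)

lemma case_nat_measurable [measurable]: "case_nat a \<in> measurable M_algebra M_algebra"
  unfolding M_algebra_def
proof (rule measurable_PiM_single')
  show "(\<lambda>x. case_nat a x i) \<in> measurable (Pi\<^sub>M UNIV (\<lambda>_. count_space UNIV)) (count_space (UNIV :: 2 set))" for i
    by (cases i) (auto intro: measurable_component_singleton)
qed auto

lemma vimage_case_nat_cyl:
  "case_nat a -` cyl x (Suc m) = (if x 0 = a then cyl (shift x) m else {})"
  by (auto simp: cyl_def shift_def less_Suc_eq_0_disj)

locale markov =
  fixes P :: "real^2^2" and \<pi> :: "real^2" and \<mu> :: "point measure"
  assumes stochastic: "positive_stochastic P"
    and stationary: "stationary_vector P \<pi>"
    and markov: "markov_probability P \<pi> \<mu>"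
begin

lemma P_pos: "P $ i $ j > 0"
  using stochastic by (simp add: positive_stochastic_def)

lemma P_nonneg: "P $ i $ j \<ge> 0"
  using P_pos by (rule less_imp_le)

lemma P_row: "P $ i $ 0 + P $ i $ 1 = 1"
  using stochastic by (simp add: positive_stochastic_def sum_letters)

lemma sets_\<mu>: "sets \<mu> = sets M_algebra"
  using markov by (simp add: markov_probability_def)

lemma pi_nonneg: "\<pi> $ i \<ge> 0"
  using stationary by (simp add: stationary_vector_def)

text \<open>
  Reversibility is special to two states: in equilibrium the flow from \<open>0\<close> to \<open>1\<close> must equal the flow
  back, since there is no other state.
\<close>

lemma detailed_balance: "\<pi> $ a * P $ a $ b = \<pi> $ b * P $ b $ a"
proof -
  have "(\<pi> v* P) $ 0 = \<pi> $ 0" using stationary by (simp add: stationary_vector_def)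
  then have "P $ 0 $ 0 * \<pi> $ 0 + P $ 1 $ 0 * \<pi> $ 1 = \<pi> $ 0"
    by (simp add: vector_matrix_mult_def sum_letters mult.commute)
  moreover have "P $ 0 $ 0 = 1 - P $ 0 $ 1" using P_row[of 0] by simp
  ultimately have "\<pi> $ 0 * P $ 0 $ 1 = \<pi> $ 1 * P $ 1 $ 0" by (simp add: algebra_simps)
  then show ?thesis using letter_cases[of a] letter_cases[of b] by auto
qed

sublocale prob_space \<mu>
  using markov by (simp add: markov_probability_def)

lemma measure_cyl: "prob (cyl x (Suc m)) = \<pi> $ x 0 * (\<Prod>k<m. P $ x k $ x (Suc k))"
  using markov by (simp add: markov_probability_def cyl_def less_Suc_eq_le)

text \<open>
  The largest transition probability \<open>\<theta>\<close> is less than \<open>1\<close> because the other entry in its row is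
  positive; so the cylinders around a point have exponentially decaying mass.
\<close>

lemma prob_point: "prob {x} = 0"
proof -
  define \<theta> where "\<theta> = Max (range (\<lambda>(i, j). P $ i $ j))"
  have le: "P $ i $ j \<le> \<theta>" for i j
    unfolding \<theta>_def by (rule Max_ge) auto
  have lt: "P $ i $ j < 1" for i j
    using letter_cases[of j] P_row[of i] P_pos[of i 0] P_pos[of i 1] by auto
  have "\<theta> \<in> range (\<lambda>(i, j). P $ i $ j)" unfolding \<theta>_def by (rule Max_in) auto
  then have "\<theta> < 1" "0 < \<theta>" using lt P_pos by auto
  have "\<pi> $ 0 + \<pi> $ 1 = 1" using stationary by (simp add: stationary_vector_def sum_letters)
  then have pi_le: "\<pi> $ i \<le> 1" for i
    using pi_nonneg[of 0] pi_nonneg[of 1] letter_cases[of i] by auto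
  have "prob {x} \<le> \<theta> ^ m" for m
  proof -
    have "prob {x} \<le> prob (cyl x (Suc m))"
      by (rule finite_measure_mono) (auto simp: sets_\<mu>)
    also have "\<dots> \<le> 1 * (\<Prod>k<m. \<theta>)"
      unfolding measure_cyl
      by (intro mult_mono prod_mono prod_nonneg pi_le pi_nonneg ballI conjI le P_nonneg) auto
    finally show ?thesis by simp
  qed
  moreover have "(\<lambda>m. \<theta> ^ m) \<longlonglongrightarrow> 0"
    using \<open>\<theta> < 1\<close> \<open>0 < \<theta>\<close> by (intro LIMSEQ_power_zero) simp
  ultimately have "prob {x} \<le> 0" by (intro LIMSEQ_le_const) auto
  then show ?thesis by (simp add: measure_le_0_iff)
qed

sublocale atomless_cantor \<mu>
  by unfold_locales (rule sets_\<mu> prob_point)+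

lemma shift_\<mu> [measurable]: "shift \<in> measurable \<mu> \<mu>"
  and case_nat_\<mu> [measurable]: "case_nat a \<in> measurable \<mu> \<mu>"
  using shift_measurable case_nat_measurable by (simp_all cong: measurable_cong_sets add: sets_\<mu>)

lemma letter_function_measurable [measurable]:
  fixes h :: "2 \<Rightarrow> 2 \<Rightarrow> real"
  shows "(\<lambda>y. h (y 0) (y 1)) \<in> borel_measurable \<mu>"
  by (rule prefix_function_borel[where m = 2]) (simp add: cyl_def)

lemma transition_measurable [measurable]: "(\<lambda>x. P $ x 0 $ a) \<in> borel_measurable \<mu>"
  using letter_function_measurable[of "\<lambda>b _. P $ b $ a"] .

lemma first_letter_event [measurable]: "{y. y 0 = a} \<in> events"
proof -
  have "{y. y 0 = a} = cyl (\<lambda>_. a) 1" by (auto simp: cyl_def)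
  then show ?thesis by simp
qed

text \<open>
  Disintegration of \<open>\<mu>\<close> along the shift, restricted to points with first letter \<open>a\<close>: given the tail
  \<open>x\<close>, the letter \<open>a\<close> has probability \<open>P $ x 0 $ a\<close>, a forward transition read backwards. On cylinders
  of length at least two this is detailed balance for the first two letters.
\<close>

lemma distr_case_nat:
  "distr (density \<mu> (\<lambda>x. ennreal (P $ x 0 $ a))) \<mu> (case_nat a)
     = density \<mu> (\<lambda>y. ennreal (indicator {y. y 0 = a} y))"
    (is "?L = ?R")
proof -
  have eq: "emeasure ?R (cyl x (Suc (Suc n))) = emeasure ?L (cyl x (Suc (Suc n)))" for x n
  proof -
    let ?C = "cyl x (Suc (Suc n))" and ?D = "cyl (shift x) (Suc n)"
    have R: "emeasure ?R ?C = (\<integral>\<^sup>+ y. ennreal (indicator {y. y 0 = a} y) * indicator ?C y \<partial>\<mu>)"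
      by (rule emeasure_density) auto
    have L: "emeasure ?L ?C = (\<integral>\<^sup>+ y. ennreal (P $ y 0 $ a) * indicator (case_nat a -` ?C) y \<partial>\<mu>)"
      using measurable_sets[OF case_nat_\<mu>, of ?C a] by (simp add: emeasure_distr emeasure_density)
    show ?thesis
    proof (cases "x 0 = a")
      case True
      have "(\<integral>\<^sup>+ y. ennreal (P $ y 0 $ a) * indicator ?D y \<partial>\<mu>)
          = (\<integral>\<^sup>+ y. ennreal (P $ x 1 $ a) * indicator ?D y \<partial>\<mu>)"
        by (intro nn_integral_cong) (auto simp: indicator_def cyl_def shift_def)
      also have "\<dots> = ennreal (P $ x 1 $ a * prob ?D)"
        using P_pos[of "x 1" a] by (simp add: nn_integral_cmult_indicator emeasure_eq_measure ennreal_mult)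
      also have "P $ x 1 $ a * prob ?D = prob ?C"
        using detailed_balance[of "x 0" "x 1"] True
        unfolding measure_cyl by (simp add: shift_def prod.lessThan_Suc_shift mult_ac del: prod.lessThan_Suc)
      finally have "emeasure ?L ?C = emeasure \<mu> ?C"
        unfolding L by (simp add: vimage_case_nat_cyl True emeasure_eq_measure)
      moreover have "emeasure ?R ?C = (\<integral>\<^sup>+ y. indicator ?C y \<partial>\<mu>)"
        unfolding R using True by (intro nn_integral_cong) (auto simp: indicator_def cyl_def)
      ultimately show ?thesis by simp
    next
      case False
      then have "emeasure ?R ?C = (\<integral>\<^sup>+ y. 0 \<partial>\<mu>)"
        unfolding R by (intro nn_integral_cong) (auto simp: indicator_def cyl_def)
      then show ?thesis unfolding L using False by (simp add: vimage_case_nat_cyl)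
    qed
  qed
  have "?R = ?L"
  proof (rule measure_eq_on_long_cylinders[where N = 2])
    show "emeasure ?R (cyl x m) = emeasure ?L (cyl x m)" if "2 \<le> m" for x m
    proof -
      from that obtain n where "m = Suc (Suc n)" by (auto dest!: le_Suc_ex)
      then show ?thesis using eq by simp
    qed
    have "emeasure ?R (cyl x 2) \<le> emeasure \<mu> (cyl x 2)" for x
    proof -
      have "emeasure ?R (cyl x 2) = (\<integral>\<^sup>+ y. ennreal (indicator {y. y 0 = a} y) * indicator (cyl x 2) y \<partial>\<mu>)"
        by (rule emeasure_density) auto
      also have "\<dots> \<le> (\<integral>\<^sup>+ y. indicator (cyl x 2) y \<partial>\<mu>)"
        by (intro nn_integral_mono) (auto simp: indicator_def)
      finally show ?thesis by simp
    qed
    then show "emeasure ?R (cyl x 2) \<noteq> \<infinity>" for x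
      by (metis emeasure_finite infinity_ennreal_def neq_top_trans)
  qed (simp_all add: sets_\<mu>)
  then show ?thesis ..
qed

definition transfer :: "(point \<Rightarrow> real) \<Rightarrow> point \<Rightarrow> real" where
  "transfer f x = (\<Sum>a\<in>UNIV. P $ x 0 $ a * f (case_nat a x))"

lemma ruelle_eq_transfer: "ruelle (markov_potential P) f = transfer f"
  using P_pos by (simp add: fun_eq_iff ruelle_expand transfer_def markov_potential_def)

text \<open>
  The dual of the transfer operator fixes \<open>\<mu>\<close>: sum the disintegration over the first letter.
\<close>

lemma transfer_dual:
  assumes u: "integrable \<mu> u"
  shows "integrable \<mu> (transfer u)" "(\<integral>x. transfer u x \<partial>\<mu>) = (\<integral>x. u x \<partial>\<mu>)"
proof -
  have [measurable]: "u \<in> borel_measurable \<mu>" using u by simp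
  let ?u = "\<lambda>a y. indicat_real {y. y 0 = a} y *\<^sub>R u y"
  let ?t = "\<lambda>a x. P $ x 0 $ a *\<^sub>R u (case_nat a x)"
  have iu: "integrable \<mu> (?u a)" for a
    by (rule integrable_mult_indicator[OF first_letter_event u])
  have meas: "case_nat a \<in> measurable (density \<mu> (\<lambda>x. ennreal (P $ x 0 $ a))) \<mu>" for a
    by simp
  have it: "integrable \<mu> (?t a)" for a
  proof -
    have "integrable (density \<mu> (\<lambda>y. ennreal (indicator {y. y 0 = a} y))) u"
      using iu[of a] by (subst integrable_density) auto
    then have "integrable (density \<mu> (\<lambda>x. ennreal (P $ x 0 $ a))) (\<lambda>x. u (case_nat a x))"
      unfolding distr_case_nat[symmetric] by (rule integrable_distr[OF meas])
    then show ?thesis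
      by (subst (asm) integrable_density) (auto simp: P_nonneg)
  qed
  have eq: "(\<integral>x. ?t a x \<partial>\<mu>) = (\<integral>y. ?u a y \<partial>\<mu>)" for a
  proof -
    have "(\<integral>y. ?u a y \<partial>\<mu>) = (\<integral>y. u y \<partial>density \<mu> (\<lambda>y. ennreal (indicator {y. y 0 = a} y)))"
      by (rule integral_density[symmetric]) auto
    also have "\<dots> = (\<integral>x. u (case_nat a x) \<partial>density \<mu> (\<lambda>x. ennreal (P $ x 0 $ a)))"
      unfolding distr_case_nat[symmetric] by (rule integral_distr[OF meas]) simp
    also have "\<dots> = (\<integral>x. ?t a x \<partial>\<mu>)"
      by (intro integral_density) (auto simp: P_nonneg)
    finally show ?thesis ..
  qed
  have t: "transfer u = (\<lambda>x. \<Sum>a\<in>UNIV. ?t a x)" by (simp add: transfer_def fun_eq_iff)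
  show "integrable \<mu> (transfer u)" unfolding t using it by (intro Bochner_Integration.integrable_sum) auto
  have sum_u: "(\<Sum>a\<in>UNIV. ?u a y) = u y" for y
    using letter_cases[of "y 0"] by (auto simp: sum_letters)
  have "(\<integral>x. transfer u x \<partial>\<mu>) = (\<Sum>a\<in>UNIV. \<integral>x. ?t a x \<partial>\<mu>)"
    unfolding t by (rule Bochner_Integration.integral_sum) (rule it)
  also have "\<dots> = (\<Sum>a\<in>UNIV. \<integral>y. ?u a y \<partial>\<mu>)" unfolding eq ..
  also have "\<dots> = (\<integral>y. (\<Sum>a\<in>UNIV. ?u a y) \<partial>\<mu>)"
    by (rule Bochner_Integration.integral_sum[symmetric]) (rule iu)
  also have "\<dots> = (\<integral>y. u y \<partial>\<mu>)" unfolding sum_u ..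
  finally show "(\<integral>x. transfer u x \<partial>\<mu>) = (\<integral>x. u x \<partial>\<mu>)" .
qed

section \<open>The kernel as a weighted copy of the whole space\<close>

text \<open>
  For each \<open>b\<close>, the function \<open>weight b\<close> is the unit vector, unique up to sign, that is orthogonal to
  the constants for the probability weights \<open>P $ b\<close>.
\<close>

definition weight :: "2 \<Rightarrow> 2 \<Rightarrow> real" where
  "weight b a = (if a = 0 then sqrt (P $ b $ 1 / P $ b $ 0) else - sqrt (P $ b $ 0 / P $ b $ 1))"

lemma weight_mean: "(\<Sum>a\<in>UNIV. P $ b $ a * weight b a) = 0"
  using P_pos[of b 0] P_pos[of b 1]
  by (simp add: sum_letters weight_def real_sqrt_divide field_simps)

lemma weight_variance: "(\<Sum>a\<in>UNIV. P $ b $ a * (weight b a)\<^sup>2) = 1"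
  using P_pos[of b 0] P_pos[of b 1] P_row[of b]
  by (simp add: sum_letters weight_def)

text \<open>
  The functions of mean zero for \<open>P $ b\<close> form a line, so each of them is its own projection onto the
  unit vector \<open>weight b\<close>.
\<close>

lemma weight_spans:
  assumes "(\<Sum>a\<in>UNIV. P $ b $ a * v a) = 0"
  shows "v a = weight b a * (\<Sum>a\<in>UNIV. P $ b $ a * (weight b a * v a))"
proof -
  \<comment> \<open>With \<open>p, q\<close> the roots of the two entries of the row, the unit vector is \<open>(q / p, - p / q)\<close>.\<close>
  define p q where "p = sqrt (P $ b $ 0)" and "q = sqrt (P $ b $ 1)"
  have pq: "p > 0" "q > 0" "P $ b $ 0 = p\<^sup>2" "P $ b $ 1 = q\<^sup>2"
    using P_pos[of b] by (simp_all add: p_def q_def P_nonneg)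
  have one: "p\<^sup>2 + q\<^sup>2 = 1" using P_row[of b] pq by simp
  have w: "weight b 0 = q / p" "weight b 1 = - (p / q)"
    by (simp_all add: weight_def p_def q_def real_sqrt_divide)
  have z: "p\<^sup>2 * v 0 + q\<^sup>2 * v 1 = 0" using assms pq by (simp add: sum_letters)
  have S: "(\<Sum>a\<in>UNIV. P $ b $ a * (weight b a * v a)) = p * q * (v 0 - v 1)"
    using pq by (simp add: sum_letters w power2_eq_square algebra_simps)
  have "q\<^sup>2 * (v 0 - v 1) = (p\<^sup>2 + q\<^sup>2) * v 0" "p\<^sup>2 * (v 0 - v 1) = - (p\<^sup>2 + q\<^sup>2) * v 1"
    using z by (simp_all add: algebra_simps)
  then have *: "q\<^sup>2 * (v 0 - v 1) = v 0" "p\<^sup>2 * (v 0 - v 1) = - v 1"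
    by (simp_all add: one)
  have "weight b 0 * (p * q * (v 0 - v 1)) = v 0" "weight b 1 * (p * q * (v 0 - v 1)) = v 1"
    using pq(1,2) * by (simp_all add: w power2_eq_square mult_ac)
  then show ?thesis unfolding S using letter_cases[of a] by auto
qed

definition lift :: "(point \<Rightarrow> real) \<Rightarrow> point \<Rightarrow> real" where
  "lift h y = weight (y 1) (y 0) * h (shift y)"

lemma lift_case_nat: "lift h (case_nat a x) = weight (x 0) a * h x"
  by (simp add: lift_def)

lemma lift_measurable [measurable]:
  assumes [measurable]: "h \<in> borel_measurable \<mu>"
  shows "lift h \<in> borel_measurable \<mu>"
proof -
  have [measurable]: "(\<lambda>y. weight (y 1) (y 0)) \<in> borel_measurable \<mu>"
    using letter_function_measurable[of "\<lambda>a b. weight b a"] .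
  show ?thesis unfolding lift_def[abs_def] by measurable
qed

definition weight_bound :: real where
  "weight_bound = (\<Sum>b\<in>UNIV. \<Sum>a\<in>UNIV. \<bar>weight b a\<bar>)"

lemma abs_weight_le: "\<bar>weight b a\<bar> \<le> weight_bound"
proof -
  have "\<bar>weight b a\<bar> \<le> (\<Sum>a\<in>UNIV. \<bar>weight b a\<bar>)" by (rule member_le_sum) auto
  also have "\<dots> \<le> weight_bound"
    unfolding weight_bound_def by (rule member_le_sum) (auto intro: sum_nonneg)
  finally show ?thesis .
qed

lemma transfer_lift: "transfer (lift h) x = 0"
proof -
  have "transfer (lift h) x = (\<Sum>a\<in>UNIV. P $ x 0 $ a * weight (x 0) a) * h x"
    by (simp add: transfer_def lift_case_nat sum_distrib_right mult.assoc)
  then show ?thesis by (simp add: weight_mean)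
qed

text \<open>
  This makes \<open>lift\<close> an isometry, because \<open>transfer\<close> preserves integrals.
\<close>

lemma transfer_lift_mult: "transfer (\<lambda>y. lift g y * lift h y) x = g x * h x"
proof -
  have "transfer (\<lambda>y. lift g y * lift h y) x = (\<Sum>a\<in>UNIV. P $ x 0 $ a * (weight (x 0) a)\<^sup>2) * (g x * h x)"
    by (simp add: transfer_def lift_case_nat sum_letters power2_eq_square algebra_simps)
  then show ?thesis by (simp add: weight_variance)
qed

text \<open>
  The inverse of \<open>lift\<close> on the kernel: it takes the coordinate along \<open>weight\<close> in each fibre of the
  shift.
\<close>

definition unlift :: "(point \<Rightarrow> real) \<Rightarrow> point \<Rightarrow> real" where
  "unlift f x = (\<Sum>a\<in>UNIV. P $ x 0 $ a * (weight (x 0) a * f (case_nat a x)))"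

lemma kernel_fibre:
  assumes "transfer f x = 0"
  shows "f (case_nat a x) = weight (x 0) a * unlift f x"
  using weight_spans[of "x 0" "\<lambda>a. f (case_nat a x)" a] assms by (simp add: transfer_def unlift_def)

lemma transfer_square_diff:
  assumes "transfer f x = 0"
  shows "transfer (\<lambda>y. (f y - lift h y)\<^sup>2) x = (unlift f x - h x)\<^sup>2"
proof -
  have "transfer (\<lambda>y. (f y - lift h y)\<^sup>2) x
      = (\<Sum>a\<in>UNIV. P $ x 0 $ a * (weight (x 0) a)\<^sup>2) * (unlift f x - h x)\<^sup>2"
    by (simp add: transfer_def lift_case_nat kernel_fibre[OF assms] sum_distrib_right mult.assoc
        power_mult_distrib flip: right_diff_distrib)
  then show ?thesis by (simp add: weight_variance)
qed

lemma unlift_measurable [measurable]: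
  assumes [measurable]: "f \<in> borel_measurable \<mu>"
  shows "unlift f \<in> borel_measurable \<mu>"
proof -
  have [measurable]: "(\<lambda>x. weight (x 0) a) \<in> borel_measurable \<mu>" for a
    using letter_function_measurable[of "\<lambda>b _. weight b a"] .
  show ?thesis unfolding unlift_def[abs_def] by measurable
qed

text \<open>
  The case \<open>h = 0\<close> shows that \<open>unlift f\<close> is square integrable; the general case turns approximation of
  \<open>unlift f\<close> into approximation of \<open>f\<close>.
\<close>

lemma unlift_isometry:
  assumes f: "f \<in> ruelle_kernel (markov_potential P) \<mu>" and h: "lift h \<in> l2_functions \<mu>"
    and hm [measurable]: "h \<in> borel_measurable \<mu>"
  shows "integrable \<mu> (\<lambda>x. (unlift f x - h x)\<^sup>2)"
    "(\<integral>y. (f y - lift h y)\<^sup>2 \<partial>\<mu>) = (\<integral>x. (unlift f x - h x)\<^sup>2 \<partial>\<mu>)"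
proof -
  have fl2: "f \<in> l2_functions \<mu>" and ker: "AE x in \<mu>. transfer f x = 0"
    using f by (simp_all add: ruelle_kernel_def ruelle_eq_transfer)
  have [measurable]: "f \<in> borel_measurable \<mu>" using fl2 by (simp add: l2_functions_def)
  have int: "integrable \<mu> (\<lambda>y. (f y - lift h y)\<^sup>2)"
    using l2_diff[OF fl2 h] by (simp add: l2_functions_def)
  have ae: "AE x in \<mu>. transfer (\<lambda>y. (f y - lift h y)\<^sup>2) x = (unlift f x - h x)\<^sup>2"
    using ker by eventually_elim (rule transfer_square_diff)
  show "integrable \<mu> (\<lambda>x. (unlift f x - h x)\<^sup>2)"
    by (rule integrable_cong_AE_imp[OF transfer_dual(1)[OF int]]) (use ae in auto)
  show "(\<integral>y. (f y - lift h y)\<^sup>2 \<partial>\<mu>) = (\<integral>x. (unlift f x - h x)\<^sup>2 \<partial>\<mu>)"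
    unfolding transfer_dual(2)[OF int, symmetric]
    by (rule integral_cong_AE)
      (use ae borel_measurable_integrable[OF transfer_dual(1)[OF int]] in auto)
qed

section \<open>The bounded basis of the kernel\<close>

definition basis :: "nat \<Rightarrow> point \<Rightarrow> real" where
  "basis n = lift (cosine n)"

lemma basis_measurable [measurable]: "basis n \<in> borel_measurable \<mu>"
  unfolding basis_def by measurable

lemma abs_basis_le: "\<bar>basis n y\<bar> \<le> weight_bound"
proof -
  have "\<bar>basis n y\<bar> \<le> weight_bound * 1"
    unfolding basis_def lift_def abs_mult
    using abs_weight_le[of 0 0] by (intro mult_mono abs_weight_le abs_cosine_le_1) auto
  then show ?thesis by simp
qed

lemma basis_l2: "basis n \<in> l2_functions \<mu>"
  by (rule bounded_l2[OF finite_measure_axioms basis_measurable abs_basis_le])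

lemma basis_inner: "l2_inner \<mu> (basis m) (basis n) = (if m = n then if n = 0 then 1 else 1/2 else 0)"
proof -
  have "l2_inner \<mu> (basis m) (basis n) = (\<integral>x. transfer (\<lambda>y. basis m y * basis n y) x \<partial>\<mu>)"
    unfolding l2_inner_def by (rule transfer_dual(2)[OF l2_integrable_mult[OF basis_l2 basis_l2], symmetric])
  then show ?thesis by (simp add: basis_def transfer_lift_mult integral_cosine_product)
qed

lemma basis_norm: "1/2 \<le> l2_norm \<mu> (basis n)" "l2_norm \<mu> (basis n) \<le> 1"
proof -
  show "1/2 \<le> l2_norm \<mu> (basis n)"
    unfolding l2_norm_def basis_inner by (rule real_le_rsqrt) (simp add: power2_eq_square)
  show "l2_norm \<mu> (basis n) \<le> 1"
    unfolding l2_norm_def basis_inner by simp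
qed

lemma basis_c0: "c0_norm (basis n) \<le> weight_bound" "l2_norm \<mu> (basis n) \<le> c0_norm (basis n)"
proof -
  show "c0_norm (basis n) \<le> weight_bound"
    unfolding c0_norm_def by (rule cSUP_least) (auto intro: abs_basis_le)
  have le: "\<bar>basis n x\<bar> \<le> c0_norm (basis n)" for x
    unfolding c0_norm_def by (rule cSUP_upper) (auto intro!: bdd_aboveI abs_basis_le)
  have "l2_inner \<mu> (basis n) (basis n) \<le> (\<integral>x. (c0_norm (basis n))\<^sup>2 \<partial>\<mu>)"
    unfolding l2_inner_def
  proof (rule integral_mono)
    show "basis n x * basis n x \<le> (c0_norm (basis n))\<^sup>2" for x
      using power_mono[OF le[of x], of 2] by (simp add: power2_eq_square)
  qed (auto intro: l2_integrable_mult basis_l2)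
  then show "l2_norm \<mu> (basis n) \<le> c0_norm (basis n)"
    unfolding l2_norm_def using prob_space le[of undefined]
    by (intro real_le_lsqrt) auto
qed

lemma basis_continuous: "continuous_map M_topology euclideanreal (basis n)"
proof -
  have "continuous_map M_topology euclideanreal (\<lambda>y. weight (y 1) (y 0))"
    by (rule continuous_map_cylindersI) (auto intro!: exI[of _ 2] simp: cyl_def)
  moreover have "continuous_map M_topology euclideanreal (\<lambda>y. lex_cdf (shift y))"
  proof (rule continuous_map_cylindersI)
    fix x and \<epsilon> :: real assume "\<epsilon> > 0"
    then obtain m where m: "\<forall>y\<in>cyl (shift x) m. \<bar>lex_cdf y - lex_cdf (shift x)\<bar> < \<epsilon>"
      using lex_cdf_prefix_continuous by blast
    have "shift y \<in> cyl (shift x) m" if "y \<in> cyl x (Suc m)" for y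
      using that by (simp add: cyl_def shift_def)
    then show "\<exists>m. \<forall>y\<in>cyl x m. \<bar>lex_cdf (shift y) - lex_cdf (shift x)\<bar> < \<epsilon>"
      using m by blast
  qed
  then have "continuous_map M_topology euclideanreal ((\<lambda>t. cos (real n * pi * t)) \<circ> (\<lambda>y. lex_cdf (shift y)))"
    by (rule continuous_map_compose) (auto intro!: continuous_intros)
  ultimately have "continuous_map M_topology euclideanreal
      (\<lambda>y. weight (y 1) (y 0) * ((\<lambda>t. cos (real n * pi * t)) \<circ> (\<lambda>y. lex_cdf (shift y))) y)"
    by (rule continuous_map_real_mult)
  then show ?thesis by (simp add: basis_def lift_def[abs_def] cosine_def)
qed

lemma basis_in_kernel: "basis n \<in> ruelle_kernel (markov_potential P) \<mu>"
  unfolding ruelle_kernel_def ruelle_eq_transfer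
  using basis_l2 transfer_lift by (simp add: basis_def)

lemma basis_dense:
  assumes f: "f \<in> ruelle_kernel (markov_potential P) \<mu>" and "\<epsilon> > 0"
  shows "\<exists>N c. l2_norm \<mu> (\<lambda>x. f x - (\<Sum>n<N. c n * basis n x)) < \<epsilon>"
proof -
  have [measurable]: "f \<in> borel_measurable \<mu>"
    using f by (simp add: ruelle_kernel_def l2_functions_def)
  have "integrable \<mu> (\<lambda>x. (unlift f x)\<^sup>2)"
    using unlift_isometry(1)[OF f, of "\<lambda>_. 0"] by (simp add: lift_def[abs_def] l2_zero)
  then have "unlift f \<in> cosines.closed_span"
    by (intro cosine_complete) (simp add: l2_functions_def)
  moreover have "\<epsilon>\<^sup>2 > 0" using \<open>\<epsilon> > 0\<close> by simp
  ultimately obtain g where "g \<in> combinations cosine" and g: "(\<integral>x. (unlift f x - g x)\<^sup>2 \<partial>\<mu>) < \<epsilon>\<^sup>2"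
    unfolding cosines.closed_span_def by blast
  then obtain N c where g_eq: "g = (\<lambda>x. \<Sum>n<N. c n * cosine n x)" by (auto simp: combinations_def)
  have lift_g: "lift g = (\<lambda>x. \<Sum>n<N. c n * basis n x)"
    by (simp add: fun_eq_iff g_eq basis_def lift_def sum_distrib_left mult.left_commute)
  have "lift g \<in> l2_functions \<mu>"
    unfolding lift_g by (intro l2_sum l2_scale basis_l2)
  moreover have "g \<in> borel_measurable \<mu>" unfolding g_eq by measurable
  ultimately have "(\<integral>y. (f y - lift g y)\<^sup>2 \<partial>\<mu>) < \<epsilon>\<^sup>2"
    using unlift_isometry(2)[OF f] g by simp
  then have "l2_norm \<mu> (\<lambda>x. f x - (\<Sum>n<N. c n * basis n x)) < \<epsilon>"
    unfolding l2_norm_def l2_inner_def lift_g using \<open>\<epsilon> > 0\<close>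
    by (intro real_less_lsqrt) (auto simp: power2_eq_square)
  then show ?thesis by blast
qed

lemma basis_orthogonal_basis: "l2_orthogonal_basis \<mu> (ruelle_kernel (markov_potential P) \<mu>) basis"
  unfolding l2_orthogonal_basis_def
proof (intro conjI allI impI ballI)
  show "l2_norm \<mu> (basis n) \<noteq> 0" for n using basis_norm(1)[of n] by simp
qed (auto simp: basis_in_kernel basis_inner intro: basis_dense)

end

theorem theorem6p4:
  fixes P :: "real^2^2" and \<pi> :: "real^2" and \<mu> :: "point measure"
  assumes "positive_stochastic P"
    and "stationary_vector P \<pi>"
    and "markov_probability P \<pi> \<mu>"
  shows "\<exists>(\<gamma> :: nat \<Rightarrow> point \<Rightarrow> real) (\<alpha>::real) (\<beta>::real).
           l2_orthogonal_basis \<mu> (ruelle_kernel (markov_potential P) \<mu>) \<gamma> \<and>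
           (\<forall>n. continuous_map M_topology euclideanreal (\<gamma> n)) \<and>
           \<alpha> > 0 \<and> \<beta> > 0 \<and>
           (\<forall>n. c0_norm (\<gamma> n) \<le> \<beta> \<and> l2_norm \<mu> (\<gamma> n) \<le> \<beta>) \<and>
           (\<forall>n. c0_norm (\<gamma> n) \<ge> \<alpha> \<and> l2_norm \<mu> (\<gamma> n) \<ge> \<alpha>)"
proof -
  interpret markov P \<pi> \<mu> using assms by unfold_locales
  have "1/2 \<le> c0_norm (basis n)" "c0_norm (basis n) \<le> max 1 weight_bound" "l2_norm \<mu> (basis n) \<le> max 1 weight_bound" for n
    using basis_norm[of n] basis_c0[of n] by auto
  then show ?thesis
    using basis_orthogonal_basis basis_continuous basis_norm(1)
    by (intro exI[of _ basis] exI[of _ "1/2"] exI[of _ "max 1 weight_bound"]) auto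
qed

end
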